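(* For every $\varepsilon,\delta>0$ there exist $n_0\in\mathbb N$ and $\gamma>0$ such that the following holds. Let $G$ be a simple connected graph on $n\ge n_0$ vertices in which at least $(1-\gamma)n$ vertices have degree at least $\delta n$. For $k\ge1$ let $L_k$ be the number of vertices of degree $k$ in a uniform spanning tree of $G$. Then $$\mathbb P\bigl(L_1\le(e^{-1}-\varepsilon)n\bigr)\le\varepsilon,\qquad \mathbb P\bigl(L_2\ge(e^{-1}+\varepsilon)n\bigr)\le\varepsilon,$$ and for every integer $k\ge3$, $$\mathbb P\left(L_k\ge\left(\frac1{(k-1)!}\cdot\frac{(k-2)^{k-2}}{e^{k-2}}+\varepsilon\right)n\right)\le\varepsilon .$$
   Context: A uniform spanning tree of a finite connected graph $G$ is a spanning tree chosen uniformly at random among all spanning trees of $G$. Degrees counted by $L_k$ are degrees in the spanning tree. *)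

theory Defs
  imports "HOL-Probability.Probability"
begin

text \<open>
  A graph on a vertex set \<open>V\<close> is given by its edge set \<open>E\<close>, where an edge is a two-element
  subset of \<open>V\<close>.  This excludes loops and parallel edges.  (The trees of the AFP entry
  \<open>Graph_Theory\<close> are defined by the absence of directed cycles in a digraph, which is not
  the notion for undirected graphs.)
\<close>

definition finite_simple_graph :: "'a set \<Rightarrow> 'a set set \<Rightarrow> bool" where
  "finite_simple_graph V E \<longleftrightarrow> finite V \<and> (\<forall>e\<in>E. e \<subseteq> V \<and> card e = 2)"

definition vertex_degree :: "'a set set \<Rightarrow> 'a \<Rightarrow> nat" where
  "vertex_degree E v = card {e \<in> E. v \<in> e}"

definition connected_graph :: "'a set \<Rightarrow> 'a set set \<Rightarrow> bool" where
  "connected_graph V E \<longleftrightarrow>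
     V \<noteq> {} \<and> (\<forall>u\<in>V. \<forall>v\<in>V. (u, v) \<in> {(x, y). {x, y} \<in> E}\<^sup>*)"

text \<open>A cycle is the list of its vertices in cyclic order, without repeating the first one.\<close>

definition graph_cycle :: "'a set set \<Rightarrow> 'a list \<Rightarrow> bool" where
  "graph_cycle E c \<longleftrightarrow>
     3 \<le> length c \<and> distinct c \<and>
     (\<forall>i<length c. {c ! i, c ! (Suc i mod length c)} \<in> E)"

definition tree_on :: "'a set \<Rightarrow> 'a set set \<Rightarrow> bool" where
  "tree_on V T \<longleftrightarrow>
     finite_simple_graph V T \<and> connected_graph V T \<and> (\<nexists>c. graph_cycle T c)"

definition spanning_trees :: "'a set \<Rightarrow> 'a set set \<Rightarrow> 'a set set set" where
  "spanning_trees V E = {T. T \<subseteq> E \<and> tree_on V T}"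

text \<open>
  The law of the uniform spanning tree.  For a finite connected graph the set of spanning trees
  is finite and nonempty, so \<^const>\<open>pmf_of_set\<close> is the uniform distribution on it; for other
  arguments the value is irrelevant.
\<close>

definition uniform_spanning_tree :: "'a set \<Rightarrow> 'a set set \<Rightarrow> 'a set set pmf" where
  "uniform_spanning_tree V E = pmf_of_set (spanning_trees V E)"

definition num_degree :: "'a set \<Rightarrow> nat \<Rightarrow> 'a set set \<Rightarrow> nat" where
  "num_degree V k T = card {v \<in> V. vertex_degree T v = k}"

end

theory Submission
  imports Defs "HOL-Computational_Algebra.Fundamental_Theorem_Algebra" "Jordan_Normal_Form.Determinant"
begin

text \<open>
  By the matrix-tree theorem the weighted count of spanning trees is a determinant, so it does not
  vanish when the weights are positive on some edges and positive multiples of one common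
  \<open>z \<notin> (-\<infinity>, 0]\<close> on the others.  Hence the number of tree edges in any edge set \<open>A\<close> has a
  real-rooted generating function, i.e. it is distributed like a sum of independent Bernoulli
  variables; with weights this also gives negative correlation of edges.  Let \<open>1 + m\<^sub>v\<close> be the
  mean degree of \<open>v\<close> in the tree, so that the \<open>m\<^sub>v\<close> have average at most \<open>1\<close>.

  The degree of \<open>v\<close> is close to \<open>1 + Poisson(m\<^sub>v)\<close> up to \<open>m\<^sub>v - variance\<close>.  Since the tree has a fixed
  number of edges and edges are negatively correlated, the sum of these errors over \<open>v\<close> is at most
  \<open>\<Sum>\<^sub>e p\<^sub>e\<^sup>2\<close>, where \<open>p\<^sub>e\<close> is the probability of \<open>e\<close>.  The bound
  \<open>p\<^sub>u\<^sub>v \<ge> 1/deg u + 1/deg v - 1/deg\<^sup>2 u - 1/deg\<^sup>2 v\<close> is nearly attained on average, as \<open>\<Sum>\<^sub>e p\<^sub>e = n - 1\<close> is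
  the sum of the main terms minus one; so \<open>\<Sum>\<^sub>e p\<^sub>e\<^sup>2 = o(n)\<close> in a dense graph.

  Applied to the edges meeting \<open>{v, w}\<close>, the Bernoulli representation bounds
  \<open>E x\<^bsup>deg v + deg w\<^esup>\<close> by almost the product of the Poisson generating functions, so \<open>\<Sum>\<^sub>v x\<^bsup>deg v\<^esup>\<close> is
  concentrated for every \<open>x \<in> [0, 1]\<close>.  Finitely many \<open>x\<close> determine finitely many coefficients,
  and \<open>L\<^sub>k\<close> is trivially small for large \<open>k\<close>.  The constants come from \<open>e\<^sup>-\<^sup>m \<ge> e\<^sup>-\<^sup>1 (2 - m)\<close>,
  \<open>m e\<^sup>-\<^sup>m \<le> e\<^sup>-\<^sup>1\<close> and \<open>m\<^bsup>k-1\<^esup> e\<^sup>-\<^sup>m \<le> m (k-2)\<^bsup>k-2\<^esup> e\<^bsup>-(k-2)\<^esup>\<close>.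
\<close>

section \<open>Finite maxima, simple paths and edges across a cut\<close>

lemma ex_max_on_finite:
  fixes f :: "'a \<Rightarrow> nat"
  assumes "finite S" "S \<noteq> {}"
  obtains x where "x \<in> S" "\<And>y. y \<in> S \<Longrightarrow> f y \<le> f x"
proof -
  have "Max (f ` S) \<in> f ` S"
    using assms by (intro Max_in) auto
  then obtain x where "x \<in> S" "f x = Max (f ` S)" by auto
  moreover have "f y \<le> Max (f ` S)" if "y \<in> S" for y
    using assms(1) that by (intro Max_ge) auto
  ultimately show ?thesis using that by auto
qed

text \<open>The path grows at its end; a step back to a vertex already on it cuts the path off
  there, which keeps it simple.\<close>

lemma rtrancl_distinct_path:
  assumes "(a, b) \<in> {(x, y). P x y}\<^sup>*"
  shows "\<exists>xs. xs \<noteq> [] \<and> distinct xs \<and> hd xs = a \<and> last xs = b \<and> successively P xs"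
  using assms
proof (induction rule: rtrancl_induct)
  case base
  show ?case by (rule exI[of _ "[a]"]) simp
next
  case (step b c)
  then obtain xs where xs: "xs \<noteq> []" "distinct xs" "hd xs = a" "last xs = b" "successively P xs"
    by blast
  show ?case
  proof (cases "c \<in> set xs")
    case True
    then obtain ys zs where "xs = ys @ c # zs"
      by (meson split_list)
    with xs show ?thesis
      by (intro exI[of _ "ys @ [c]"]) (auto simp: successively_append_iff hd_append)
  next
    case False
    with xs step(2) show ?thesis
      by (intro exI[of _ "xs @ [c]"]) (auto simp: successively_append_iff)
  qed
qed

text \<open>Follow a walk from \<open>S\<close> to its complement: until an edge crosses, the walk
  is still in \<open>S\<close>.\<close>

lemma crossing_edge:
  assumes "finite_simple_graph V E" "connected_graph V E" "S \<subseteq> V" "S \<noteq> {}" "S \<noteq> V"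
  obtains u v where "u \<in> S" "v \<in> V - S" "{u, v} \<in> E"
proof -
  obtain a b where ab: "a \<in> S" "b \<in> V - S"
    using assms(3-5) by blast
  have "(a, b) \<in> {(x, y). {x, y} \<in> E}\<^sup>*"
    using assms(2,3) ab unfolding connected_graph_def by blast
  then have "b \<in> S \<or> (\<exists>u\<in>S. \<exists>v\<in>V - S. {u, v} \<in> E)"
  proof (induction rule: rtrancl_induct)
    case (step y z)
    then have "z \<in> V"
      using assms(1) unfolding finite_simple_graph_def by auto
    with step show ?case by auto
  qed (use ab in auto)
  with ab that show ?thesis by blast
qed

lemma finite_edges: "finite_simple_graph V E \<Longrightarrow> finite E"
  unfolding finite_simple_graph_def by (meson Pow_iff finite_Pow_iff rev_finite_subset subsetI)

lemma edge_eq: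
  assumes "finite_simple_graph V E" "e \<in> E" "u \<in> e"
  obtains v where "e = {u, v}" "u \<noteq> v" "u \<in> V" "v \<in> V"
proof -
  have e: "e \<subseteq> V" "card e = 2"
    using assms(1,2) unfolding finite_simple_graph_def by auto
  from e(2) obtain x y where xy: "e = {x, y}" "x \<noteq> y"
    by (auto simp: card_2_iff)
  with e(1) assms(3) that[of y] that[of x] show ?thesis
    by (auto simp: insert_commute)
qed

section \<open>Spanning trees as parent maps\<close>

text \<open>\<open>\<phi>\<close> sends each vertex to its neighbour towards the root
  \<open>r\<close>. Extensionality fixes the map by its values off the root, so that trees and
  parent maps correspond one to one; iterates matter only up to the first visit of
  \<open>r\<close>.\<close>

definition parent_map :: "'a set \<Rightarrow> 'a \<Rightarrow> ('a \<Rightarrow> 'a) \<Rightarrow> bool" where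
  "parent_map V r \<phi> \<longleftrightarrow> \<phi> \<in> (V - {r}) \<rightarrow>\<^sub>E V \<and> (\<forall>v\<in>V. \<exists>k. (\<phi> ^^ k) v = r)"

definition depth :: "'a \<Rightarrow> ('a \<Rightarrow> 'a) \<Rightarrow> 'a \<Rightarrow> nat" where
  "depth r \<phi> v = (LEAST k. (\<phi> ^^ k) v = r)"

definition tree_of :: "'a set \<Rightarrow> 'a \<Rightarrow> ('a \<Rightarrow> 'a) \<Rightarrow> 'a set set" where
  "tree_of V r \<phi> = (\<lambda>v. {v, \<phi> v}) ` (V - {r})"

lemma parent_map_in: "parent_map V r \<phi> \<Longrightarrow> v \<in> V - {r} \<Longrightarrow> \<phi> v \<in> V"
  unfolding parent_map_def by auto

lemma depth_parent:
  assumes "parent_map V r \<phi>" "v \<in> V - {r}"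
  shows "depth r \<phi> v = Suc (depth r \<phi> (\<phi> v))"
proof -
  obtain k where "(\<phi> ^^ k) v = r"
    using assms unfolding parent_map_def by blast
  then have "(LEAST k. (\<phi> ^^ k) v = r) = Suc (LEAST k. (\<phi> ^^ Suc k) v = r)"
    by (rule Least_Suc) (use assms(2) in auto)
  then show ?thesis
    unfolding depth_def by (simp add: funpow_Suc_right del: funpow.simps)
qed

text \<open>Depth orients tree edges: the two ends differ by exactly one, and the child is the
  deeper end.\<close>

lemma tree_of_edgeD:
  assumes "parent_map V r \<phi>" "{a, b} \<in> tree_of V r \<phi>" "depth r \<phi> b \<le> depth r \<phi> a"
  shows "b = \<phi> a"
proof -
  from assms(2) obtain v where v: "v \<in> V - {r}" "{a, b} = {v, \<phi> v}"
    unfolding tree_of_def by auto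
  with depth_parent[OF assms(1) v(1)] assms(3) show ?thesis
    by (auto simp: doubleton_eq_iff)
qed

lemma inj_on_parent_edge:
  assumes "parent_map V r \<phi>"
  shows "inj_on (\<lambda>v. {v, \<phi> v}) (V - {r})"
proof (rule inj_onI)
  fix u v assume uv: "u \<in> V - {r}" "v \<in> V - {r}" "{u, \<phi> u} = {v, \<phi> v}"
  with depth_parent[OF assms uv(1)] depth_parent[OF assms uv(2)] show "u = v"
    by (auto simp: doubleton_eq_iff)
qed

lemma parent_map_reaches_root:
  assumes "parent_map V r \<phi>" "v \<in> V"
  shows "(v, r) \<in> {(x, y). {x, y} \<in> tree_of V r \<phi>}\<^sup>*"
  using assms(2)
proof (induction "depth r \<phi> v" arbitrary: v rule: less_induct)
  case less
  show ?case
  proof (cases "v = r")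
    case False
    then have v: "v \<in> V - {r}" using less(2) by blast
    have "(\<phi> v, r) \<in> {(x, y). {x, y} \<in> tree_of V r \<phi>}\<^sup>*"
      using less(1) depth_parent[OF assms(1) v] parent_map_in[OF assms(1) v] by simp
    moreover have "{v, \<phi> v} \<in> tree_of V r \<phi>"
      using v unfolding tree_of_def by blast
    ultimately show ?thesis
      by (meson case_prodI converse_rtrancl_into_rtrancl mem_Collect_eq)
  qed simp
qed

lemma connected_tree_of:
  assumes "parent_map V r \<phi>" "r \<in> V"
  shows "connected_graph V (tree_of V r \<phi>)"
proof -
  let ?R = "{(x, y). {x, y} \<in> tree_of V r \<phi>}"
  have "sym ?R" by (auto simp: sym_def insert_commute)
  then have "sym (?R\<^sup>*)" by (rule sym_rtrancl)
  then have "(u, v) \<in> ?R\<^sup>*" if "u \<in> V" "v \<in> V" for u v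
    using parent_map_reaches_root[OF assms(1)] that by (meson rtrancl_trans symD)
  with assms(2) show ?thesis
    unfolding connected_graph_def by blast
qed

text \<open>At a deepest vertex of a cycle, both cyclic neighbours would have to be its
  parent.\<close>

lemma no_cycle_tree_of:
  assumes "parent_map V r \<phi>"
  shows "\<not> graph_cycle (tree_of V r \<phi>) c"
proof
  assume c: "graph_cycle (tree_of V r \<phi>) c"
  define n where "n = length c"
  have n: "3 \<le> n" and dist: "distinct c"
    and edge: "\<And>i. i < n \<Longrightarrow> {c ! i, c ! (Suc i mod n)} \<in> tree_of V r \<phi>"
    using c unfolding graph_cycle_def n_def by auto
  have "{..<n} \<noteq> {}" using n by (auto simp: lessThan_empty_iff)
  then obtain i where i: "i < n" "\<And>j. j < n \<Longrightarrow> depth r \<phi> (c ! j) \<le> depth r \<phi> (c ! i)"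
    using ex_max_on_finite[of "{..<n}" "\<lambda>i. depth r \<phi> (c ! i)"] by auto
  \<comment> \<open>\<open>h\<close> is the cyclic predecessor of \<open>i\<close> and
    \<open>j\<close> below the successor; they differ because the length is at least 3.\<close>
  define h where "h = (if i = 0 then n - 1 else i - 1)"
  have h: "h < n" "Suc h mod n = i"
    using n i(1) unfolding h_def by auto
  define j where "j = Suc i mod n"
  have j: "j < n" "j \<noteq> h"
    using n i(1) unfolding j_def h_def
    by (auto simp: mod_Suc split: if_splits)
  have "c ! j = \<phi> (c ! i)"
    using tree_of_edgeD[OF assms edge[OF i(1)]] i(2) j(1) unfolding j_def by blast
  moreover have "c ! h = \<phi> (c ! i)"
    using tree_of_edgeD[OF assms] edge[OF h(1)] i(2)[OF h(1)] h by (metis insert_commute)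
  ultimately show False
    using dist j h(1) unfolding n_def by (metis nth_eq_iff_index_eq)
qed

lemma tree_on_tree_of:
  assumes "finite V" "r \<in> V" "parent_map V r \<phi>"
  shows "tree_on V (tree_of V r \<phi>)"
proof -
  have "card {v, \<phi> v} = 2" if "v \<in> V - {r}" for v
    using depth_parent[OF assms(3) that] by (metis card_2_iff n_not_Suc_n)
  then have "finite_simple_graph V (tree_of V r \<phi>)"
    using assms(1) parent_map_in[OF assms(3)]
    unfolding finite_simple_graph_def tree_of_def by auto
  then show ?thesis
    unfolding tree_on_def using connected_tree_of no_cycle_tree_of assms by metis
qed

text \<open>Among the vertices where the maps disagree, take \<open>v\<close> of maximal depth under
  \<open>\<phi>\<close>. The edge \<open>{v, \<psi> v}\<close> can lie in the tree of
  \<open>\<phi>\<close> only as the parent edge of \<open>\<psi> v\<close>, so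
  \<open>\<psi> v\<close> is deeper. The maps disagree there too, since otherwise
  \<open>\<psi>\<close> would have a 2-cycle.\<close>

lemma inj_on_tree_of:
  assumes "finite V"
  shows "inj_on (tree_of V r) {\<phi>. parent_map V r \<phi>}"
proof (rule inj_onI, unfold mem_Collect_eq)
  fix \<phi> \<psi> assume pm: "parent_map V r \<phi>" "parent_map V r \<psi>" and eq: "tree_of V r \<phi> = tree_of V r \<psi>"
  define S where "S = {v \<in> V - {r}. \<phi> v \<noteq> \<psi> v}"
  have "S = {}"
  proof (rule ccontr)
    assume "S \<noteq> {}"
    moreover have "finite S" using assms unfolding S_def by simp
    ultimately obtain v where v: "v \<in> S" "\<And>u. u \<in> S \<Longrightarrow> depth r \<phi> u \<le> depth r \<phi> v"
      using ex_max_on_finite by metis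
    then have vV: "v \<in> V - {r}" and ne: "\<phi> v \<noteq> \<psi> v"
      unfolding S_def by auto
    have "{v, \<psi> v} \<in> tree_of V r \<phi>"
      using vV unfolding eq unfolding tree_of_def by blast
    then obtain u where u: "u \<in> V - {r}" "{v, \<psi> v} = {u, \<phi> u}"
      unfolding tree_of_def by auto
    with ne have u': "u = \<psi> v" "\<phi> u = v"
      by (auto simp: doubleton_eq_iff)
    have "\<psi> u \<noteq> v"
      using depth_parent[OF pm(2) vV] depth_parent[OF pm(2) u(1)] u'(1) by auto
    then have "u \<in> S" using u(1) u'(2) unfolding S_def by auto
    with v(2) depth_parent[OF pm(1) u(1)] u'(2) show False by fastforce
  qed
  then show "\<phi> = \<psi>"
    using pm unfolding S_def parent_map_def by (auto intro: PiE_ext)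
qed

text \<open>Each vertex picks a neighbour strictly closer to \<open>r\<close>. All edges at
  \<open>r\<close> survive because only \<open>r\<close> has distance 0; this later yields a
  spanning tree through any prescribed edge.\<close>

lemma bfs_parent_map:
  assumes "finite_simple_graph V E" "connected_graph V E" "r \<in> V"
  obtains \<phi> where "parent_map V r \<phi>" "tree_of V r \<phi> \<subseteq> E" "\<And>a. {a, r} \<in> E \<Longrightarrow> {a, r} \<in> tree_of V r \<phi>"
proof -
  let ?R = "{(x, y). {x, y} \<in> E}"
  define D where "D v = (LEAST k. (v, r) \<in> ?R ^^ k)" for v
  have D: "(v, r) \<in> ?R ^^ D v" if v: "v \<in> V" for v
  proof -
    have "(v, r) \<in> ?R\<^sup>*"
      using assms(2,3) v unfolding connected_graph_def by blast
    then show ?thesis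
      unfolding D_def by (meson LeastI_ex rtrancl_imp_relpow)
  qed
  have step: "\<exists>u. {v, u} \<in> E \<and> D u < D v" if v: "v \<in> V - {r}" for v
  proof -
    obtain k where k: "D v = Suc k"
      using D[of v] v by (cases "D v") auto
    then obtain u where u: "{v, u} \<in> E" "(u, r) \<in> ?R ^^ k"
      using D[of v] v by (metis (no_types, lifting) DiffD1 case_prodD mem_Collect_eq relpow_Suc_D2)
    then have "D u \<le> k"
      unfolding D_def by (meson Least_le)
    with u k show ?thesis by auto
  qed
  define \<phi> where "\<phi> = restrict (\<lambda>v. SOME u. {v, u} \<in> E \<and> D u < D v) (V - {r})"
  have \<phi>: "{v, \<phi> v} \<in> E" "D (\<phi> v) < D v" if "v \<in> V - {r}" for v
    using someI_ex[OF step[OF that]] that unfolding \<phi>_def by auto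
  have \<phi>V: "\<phi> v \<in> V" if "v \<in> V - {r}" for v
    using \<phi>(1)[OF that] assms(1) unfolding finite_simple_graph_def by auto
  have "\<exists>k. (\<phi> ^^ k) v = r" if "v \<in> V" for v
    using that
  proof (induction "D v" arbitrary: v rule: less_induct)
    case less
    show ?case
    proof (cases "v = r")
      case True
      then show ?thesis by (intro exI[of _ 0]) simp
    next
      case False
      then obtain k where "(\<phi> ^^ k) (\<phi> v) = r"
        using less \<phi>(2)[of v] \<phi>V[of v] by blast
      then show ?thesis
        by (intro exI[of _ "Suc k"]) (simp add: funpow_Suc_right del: funpow.simps)
    qed
  qed
  moreover have "\<phi> \<in> (V - {r}) \<rightarrow>\<^sub>E V"
    using \<phi>V unfolding \<phi>_def by (auto simp: PiE_iff)
  ultimately have pm: "parent_map V r \<phi>"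
    unfolding parent_map_def by blast
  have sub: "tree_of V r \<phi> \<subseteq> E"
    using \<phi>(1) unfolding tree_of_def by auto
  have "{a, r} \<in> tree_of V r \<phi>" if e: "{a, r} \<in> E" for a
  proof -
    have "\<forall>e\<in>E. e \<subseteq> V \<and> card e = 2"
      using assms(1) unfolding finite_simple_graph_def by (rule conjunct2)
    from bspec[OF this e] have a: "a \<in> V - {r}" by auto
    have "(a, r) \<in> ?R ^^ 1" using e by simp
    then have "D a \<le> 1" unfolding D_def by (rule Least_le)
    then have "D (\<phi> a) = 0" using \<phi>(2)[OF a] by simp
    then have "\<phi> a = r" using D[OF \<phi>V[OF a]] by simp
    then show ?thesis using a unfolding tree_of_def by auto
  qed
  from that[OF pm sub this] show ?thesis .
qed

text \<open>A breadth-first tree inside \<open>T\<close> exhausts \<open>T\<close>: a further edge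
  would close a cycle with the path that joins its ends in the breadth-first tree.\<close>

lemma tree_on_imp_tree_of:
  assumes "tree_on V T" "r \<in> V"
  shows "\<exists>\<phi>. parent_map V r \<phi> \<and> tree_of V r \<phi> = T"
proof -
  have fsg: "finite_simple_graph V T" and con: "connected_graph V T"
    and nocyc: "\<And>c. \<not> graph_cycle T c"
    using assms(1) unfolding tree_on_def by auto
  obtain \<phi> where pm: "parent_map V r \<phi>" and sub: "tree_of V r \<phi> \<subseteq> T"
    by (rule bfs_parent_map[OF fsg con assms(2)]) (rule that)
  have "e \<in> tree_of V r \<phi>" if e: "e \<in> T" for e
  proof (rule ccontr)
    assume ne: "e \<notin> tree_of V r \<phi>"
    obtain a where "a \<in> e"
      using e fsg unfolding finite_simple_graph_def by fastforce
    then obtain b where ab: "e = {a, b}" "a \<noteq> b" "a \<in> V" "b \<in> V"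
      using edge_eq[OF fsg e] by metis
    have "(a, b) \<in> {(x, y). {x, y} \<in> tree_of V r \<phi>}\<^sup>*"
      using connected_tree_of[OF pm assms(2)] ab unfolding connected_graph_def by blast
    then obtain xs where xs: "xs \<noteq> []" "distinct xs" "hd xs = a" "last xs = b"
      "successively (\<lambda>x y. {x, y} \<in> tree_of V r \<phi>) xs"
      using rtrancl_distinct_path by metis
    \<comment> \<open>A path with one vertex would give \<open>a = b\<close>, and one with two
      vertices would be the edge \<open>e\<close> itself.\<close>
    have len: "3 \<le> length xs"
    proof (rule ccontr)
      assume "\<not> 3 \<le> length xs"
      then have "length xs = 1 \<or> length xs = 2"
        using xs(1) by (cases xs) (auto simp: le_Suc_eq not_le less_Suc_eq numeral_eq_Suc)
      then show False
        using xs ab ne by (auto simp: length_Suc_conv numeral_2_eq_2)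
    qed
    have "{xs ! i, xs ! (Suc i mod length xs)} \<in> T" if i: "i < length xs" for i
    proof (cases "Suc i < length xs")
      case True
      then show ?thesis
        using successively_nth[OF xs(5) True] sub by auto
    next
      case False
      then have "i = length xs - 1" "Suc i = length xs" using i by auto
      then show ?thesis
        using xs ab(1) e by (simp add: last_conv_nth hd_conv_nth insert_commute)
    qed
    with len xs(2) have "graph_cycle T xs"
      unfolding graph_cycle_def by blast
    with nocyc show False by blast
  qed
  with sub pm show ?thesis by blast
qed

lemma bij_betw_tree_of:
  assumes "finite V" "r \<in> V"
  shows "bij_betw (tree_of V r) {\<phi>. parent_map V r \<phi> \<and> tree_of V r \<phi> \<subseteq> E} (spanning_trees V E)"
  unfolding bij_betw_def
proof
  show "inj_on (tree_of V r) {\<phi>. parent_map V r \<phi> \<and> tree_of V r \<phi> \<subseteq> E}"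
    by (rule inj_on_subset[OF inj_on_tree_of[OF assms(1)]]) auto
  show "tree_of V r ` {\<phi>. parent_map V r \<phi> \<and> tree_of V r \<phi> \<subseteq> E} = spanning_trees V E"
    using tree_on_imp_tree_of[OF _ assms(2)] tree_on_tree_of[OF assms]
    unfolding spanning_trees_def by blast
qed

lemma card_spanning_tree:
  assumes "finite V" "V \<noteq> {}" "T \<in> spanning_trees V E"
  shows "card T = card V - 1"
proof -
  obtain r where r: "r \<in> V" using assms(2) by blast
  have "tree_on V T" using assms(3) unfolding spanning_trees_def by simp
  from tree_on_imp_tree_of[OF this r] obtain \<phi> where \<phi>: "parent_map V r \<phi>" "tree_of V r \<phi> = T"
    by blast
  then show ?thesis
    using card_image[OF inj_on_parent_edge[OF \<phi>(1)]] r assms(1) unfolding tree_of_def by simp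
qed

section \<open>The matrix-tree theorem\<close>

locale indexed_vertices =
  fixes V :: "'a set" and r :: 'a and n :: nat and ix :: "nat \<Rightarrow> 'a"
  assumes finite_V: "finite V" and r_in: "r \<in> V" and bij_ix: "bij_betw ix {0..<n} (V - {r})"
begin

definition jx :: "'a \<Rightarrow> nat" where "jx = the_inv_into {0..<n} ix"

lemma ix_jx: "v \<in> V - {r} \<Longrightarrow> ix (jx v) = v"
  unfolding jx_def using bij_ix by (metis bij_betw_def f_the_inv_into_f)

lemma jx_ix: "i < n \<Longrightarrow> jx (ix i) = i"
  unfolding jx_def using bij_ix by (intro the_inv_into_f_f) (auto simp: bij_betw_def)

lemma ix_in: "i < n \<Longrightarrow> ix i \<in> V - {r}"
  using bij_ix by (auto simp: bij_betw_def)

lemma jx_less: "v \<in> V - {r} \<Longrightarrow> jx v < n"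
  using bij_betwE[OF bij_betw_the_inv_into[OF bij_ix]] unfolding jx_def by auto

text \<open>The Laplacian with the row and column of the root deleted; an arc into the root enters
  only the diagonal. Weights belong to arcs rather than edges, so each row can be expanded on its
  own.\<close>

definition lap :: "('a \<Rightarrow> 'a \<Rightarrow> 'b) \<Rightarrow> 'b :: field mat" where
  "lap c = mat n n (\<lambda>(i, j). \<Sum>u\<in>V. c (ix i) u * ((if j = i then 1 else 0) - (if ix j = u then 1 else 0)))"

lemma lap_carrier: "lap c \<in> carrier_mat n n"
  unfolding lap_def by simp

text \<open>Read as a function on \<open>V\<close> that vanishes at the root, a kernel vector is
  thereby harmonic at all other vertices.\<close>

lemma lap_mult_vec:
  assumes x: "dim_vec x = n" and X: "X r = 0" "\<And>i. i < n \<Longrightarrow> X (ix i) = x $ i" and i: "i < n"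
  shows "(lap c *\<^sub>v x) $ i = (\<Sum>u\<in>V. c (ix i) u * (X (ix i) - X u))"
proof -
  have pick: "(\<Sum>j\<in>{0..<n}. (if ix j = u then 1 else 0) * x $ j) = X u" if u: "u \<in> V" for u
  proof (cases "u = r")
    case True
    then show ?thesis
      using ix_in X(1) by (intro trans[OF sum.neutral]) auto
  next
    case False
    then have u': "u \<in> V - {r}" using u by blast
    then have "(\<Sum>j\<in>{0..<n}. (if ix j = u then 1 else 0) * x $ j) = (\<Sum>j\<in>{0..<n}. if j = jx u then x $ j else 0)"
      using ix_jx jx_ix by (intro sum.cong) auto
    also have "\<dots> = X u"
      using jx_less[OF u'] X(2)[OF jx_less[OF u']] ix_jx[OF u'] by simp
    finally show ?thesis .
  qed
  have "(lap c *\<^sub>v x) $ i = (\<Sum>j\<in>{0..<n}. (\<Sum>u\<in>V. c (ix i) u * ((if j = i then 1 else 0) - (if ix j = u then 1 else 0))) * x $ j)"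
    using x i unfolding lap_def by (simp add: scalar_prod_def)
  also have "\<dots> = (\<Sum>u\<in>V. c (ix i) u * ((\<Sum>j\<in>{0..<n}. (if j = i then 1 else 0) * x $ j)
      - (\<Sum>j\<in>{0..<n}. (if ix j = u then 1 else 0) * x $ j)))"
    unfolding sum_distrib_right sum_subtractf[symmetric] sum_distrib_left
    by (subst sum.swap) (simp add: algebra_simps)
  also have "\<dots> = (\<Sum>u\<in>V. c (ix i) u * (X (ix i) - X u))"
    using pick i X(2)[OF i] by (intro sum.cong) (auto simp: if_distrib[of "\<lambda>a. a * _"] cong: if_cong)
  finally show ?thesis .
qed

definition parent_weight :: "('a \<Rightarrow> 'a) \<Rightarrow> 'a \<Rightarrow> 'a \<Rightarrow> 'b :: field" where
  "parent_weight \<phi> v u = (if u = \<phi> v then 1 else 0)"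

lemma lap_parent_weight:
  assumes "\<phi> \<in> (V - {r}) \<rightarrow>\<^sub>E V" "i < n" "j < n"
  shows "lap (parent_weight \<phi>) $$ (i, j) = (if j = i then 1 else 0) - (if ix j = \<phi> (ix i) then 1 else (0::'b::field))"
proof -
  have "\<phi> (ix i) \<in> V"
    using assms ix_in by blast
  then show ?thesis
    using finite_V assms(2,3) unfolding lap_def parent_weight_def by (simp add: if_distrib[of "\<lambda>a. a * _"] cong: if_cong)
qed

text \<open>Only the identity contributes to the Leibniz formula. If another permutation had nonzero
  entries throughout, \<open>\<phi>\<close> would follow one of its nontrivial orbits forever and
  never reach the root.\<close>

lemma det_lap_parent_map:
  assumes pm: "parent_map V r \<phi>"
  shows "Determinant.det (lap (parent_weight \<phi>)) = (1::'b::field)"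
proof -
  let ?N = "lap (parent_weight \<phi>) :: 'b mat"
  have PiE: "\<phi> \<in> (V - {r}) \<rightarrow>\<^sub>E V"
    using pm unfolding parent_map_def by blast
  have nfix: "\<phi> v \<noteq> v" if "v \<in> V - {r}" for v
    using depth_parent[OF pm that] by (metis n_not_Suc_n)
  have zero: "(\<Prod>i = 0..<n. ?N $$ (i, p i)) = 0" if p: "p permutes {0..<n}" "p \<noteq> id" for p
  proof (rule ccontr)
    assume "(\<Prod>i = 0..<n. ?N $$ (i, p i)) \<noteq> 0"
    then have nz: "?N $$ (i, p i) \<noteq> 0" if "i < n" for i
      using that by simp
    have pn: "p i < n" if "i < n" for i
      using permutes_in_image[OF p(1)] that by simp
    have move: "ix (p i) = \<phi> (ix i)" if "i < n" "p i \<noteq> i" for i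
      using nz[OF that(1)] that lap_parent_weight[OF PiE that(1) pn[OF that(1)], where 'b = 'b]
      by (auto split: if_splits)
    obtain i where i: "p i \<noteq> i" using p(2) by fastforce
    then have "i < n"
      using permutes_not_in[OF p(1)] by fastforce
    have orbit: "(p ^^ k) i < n \<and> p ((p ^^ k) i) \<noteq> (p ^^ k) i \<and> ix ((p ^^ k) i) = (\<phi> ^^ k) (ix i)" for k
    proof (induction k)
      case 0
      show ?case using i \<open>i < n\<close> by simp
    next
      case (Suc k)
      moreover have "inj p" using p(1) by (rule permutes_inj)
      ultimately show ?case
        using move pn by (auto dest: injD)
    qed
    obtain k where "(\<phi> ^^ k) (ix i) = r"
      using pm ix_in[OF \<open>i < n\<close>] unfolding parent_map_def by blast
    with orbit[of k] ix_in show False by (metis DiffD2 singletonI)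
  qed
  have "Determinant.det ?N = (\<Sum>p | p permutes {0..<n}. signof p * (\<Prod>i = 0..<n. ?N $$ (i, p i)))"
    by (rule det_def'[OF lap_carrier])
  also have "\<dots> = (\<Sum>p\<in>{id}. signof p * (\<Prod>i = 0..<n. ?N $$ (i, p i)))"
    using zero by (intro sum.mono_neutral_right) (auto simp: finite_permutations permutes_id)
  also have "\<dots> = 1"
    using lap_parent_weight[OF PiE, where 'b = 'b] nfix[symmetric] ix_in by (auto intro!: prod.neutral)
  finally show ?thesis .
qed

text \<open>The indicator of the vertices that never reach the root is a nonzero kernel vector,
  since \<open>\<phi>\<close> preserves both classes of vertices.\<close>

lemma det_lap_not_parent_map:
  assumes PiE: "\<phi> \<in> (V - {r}) \<rightarrow>\<^sub>E V" and npm: "\<not> parent_map V r \<phi>"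
  shows "Determinant.det (lap (parent_weight \<phi>)) = (0::'b::field)"
proof -
  let ?reach = "\<lambda>v. \<exists>k. (\<phi> ^^ k) v = r"
  define X :: "'a \<Rightarrow> 'b" where "X v = (if ?reach v then 0 else 1)" for v
  define x where "x = vec n (\<lambda>i. X (ix i))"
  have Xr: "X r = 0"
    unfolding X_def by (auto intro: exI[of _ 0])
  obtain v where v: "v \<in> V" "\<not> ?reach v"
    using PiE npm unfolding parent_map_def by blast
  then have v': "v \<in> V - {r}"
    using Xr unfolding X_def by (metis DiffI singletonD zero_neq_one)
  have step: "?reach v = ?reach (\<phi> v)" if "v \<in> V - {r}" for v
  proof
    assume "?reach v"
    then obtain k where k: "(\<phi> ^^ k) v = r" by blast
    with that obtain l where "k = Suc l" by (cases k) auto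
    with k show "?reach (\<phi> v)"
      by (auto simp: funpow_Suc_right simp del: funpow.simps)
  next
    assume "?reach (\<phi> v)"
    then obtain k where "(\<phi> ^^ Suc k) v = r"
      by (auto simp: funpow_Suc_right simp del: funpow.simps)
    then show "?reach v" by blast
  qed
  have "(lap (parent_weight \<phi>) *\<^sub>v x) $ i = 0" if i: "i < n" for i
  proof -
    have "(lap (parent_weight \<phi>) *\<^sub>v x) $ i = (\<Sum>u\<in>V. parent_weight \<phi> (ix i) u * (X (ix i) - X u))"
      using i Xr by (intro lap_mult_vec) (auto simp: x_def)
    also have "\<dots> = 0"
      using step[OF ix_in[OF i]] by (intro sum.neutral) (auto simp: parent_weight_def X_def)
    finally show ?thesis .
  qed
  then have "lap (parent_weight \<phi>) *\<^sub>v x = 0\<^sub>v n"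
    by (intro eq_vecI) (auto simp: lap_def)
  moreover have "x $ jx v = 1"
    using v v' ix_jx jx_less unfolding x_def X_def by auto
  then have "x \<noteq> 0\<^sub>v n"
    using jx_less[OF v'] by auto
  ultimately show ?thesis
    using det_0_iff_vec_prod_zero_field[OF lap_carrier] unfolding x_def by (metis vec_carrier)
qed

text \<open>Multilinearity in the rows: the row of \<open>v\<close> is the combination, with
  coefficients \<open>c v u\<close>, of the rows in which \<open>v\<close> has the single arc to
  \<open>u\<close>. Choosing one \<open>u\<close> per row is choosing a map
  \<open>\<phi>\<close>.\<close>

lemma det_lap:
  fixes c :: "'a \<Rightarrow> 'a \<Rightarrow> 'b :: field"
  shows "Determinant.det (lap c) = (\<Sum>\<phi>\<in>(V - {r}) \<rightarrow>\<^sub>E V.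
     (\<Prod>v\<in>V - {r}. c v (\<phi> v)) * Determinant.det (lap (parent_weight \<phi>)))"
proof -
  let ?m = "\<lambda>p v u. (if p (jx v) = jx v then 1 else 0) - (if ix (p (jx v)) = u then 1 else (0::'b))"
  have expand: "(\<Prod>i = 0..<n. lap c $$ (i, p i)) =
      (\<Sum>\<phi>\<in>(V - {r}) \<rightarrow>\<^sub>E V. (\<Prod>v\<in>V - {r}. c v (\<phi> v)) * (\<Prod>i = 0..<n. lap (parent_weight \<phi>) $$ (i, p i)))"
    if p: "p permutes {0..<n}" for p
  proof -
    have pn: "p i < n" if "i < n" for i
      using permutes_in_image[OF p] that by simp
    have "(\<Prod>i = 0..<n. lap c $$ (i, p i)) = (\<Prod>i = 0..<n. \<Sum>u\<in>V. c (ix i) u * ?m p (ix i) u)"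
      using pn jx_ix by (intro prod.cong) (auto simp: lap_def)
    also have "\<dots> = (\<Prod>v\<in>V - {r}. \<Sum>u\<in>V. c v u * ?m p v u)"
      by (rule prod.reindex_bij_betw[OF bij_ix])
    also have "\<dots> = (\<Sum>\<phi>\<in>(V - {r}) \<rightarrow>\<^sub>E V. \<Prod>v\<in>V - {r}. c v (\<phi> v) * ?m p v (\<phi> v))"
      using finite_V by (intro prod_sum_PiE) auto
    also have "\<dots> = (\<Sum>\<phi>\<in>(V - {r}) \<rightarrow>\<^sub>E V. (\<Prod>v\<in>V - {r}. c v (\<phi> v)) *
        (\<Prod>i = 0..<n. lap (parent_weight \<phi>) $$ (i, p i)))"
    proof (rule sum.cong[OF refl])
      fix \<phi> assume \<phi>: "\<phi> \<in> (V - {r}) \<rightarrow>\<^sub>E V"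
      have "(\<Prod>v\<in>V - {r}. ?m p v (\<phi> v)) = (\<Prod>i = 0..<n. ?m p (ix i) (\<phi> (ix i)))"
        by (rule prod.reindex_bij_betw[OF bij_ix, symmetric])
      also have "\<dots> = (\<Prod>i = 0..<n. lap (parent_weight \<phi>) $$ (i, p i))"
        using pn jx_ix by (intro prod.cong) (auto simp: lap_parent_weight[OF \<phi>])
      finally show "(\<Prod>v\<in>V - {r}. c v (\<phi> v) * ?m p v (\<phi> v)) = (\<Prod>v\<in>V - {r}. c v (\<phi> v)) *
          (\<Prod>i = 0..<n. lap (parent_weight \<phi>) $$ (i, p i))"
        by (simp add: prod.distrib)
    qed
    finally show ?thesis .
  qed
  have "Determinant.det (lap c) = (\<Sum>p | p permutes {0..<n}. \<Sum>\<phi>\<in>(V - {r}) \<rightarrow>\<^sub>E V.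
      (\<Prod>v\<in>V - {r}. c v (\<phi> v)) * (signof p * (\<Prod>i = 0..<n. lap (parent_weight \<phi>) $$ (i, p i))))"
    unfolding det_def'[OF lap_carrier] using expand
    by (intro sum.cong) (auto simp: sum_distrib_left mult_ac)
  also have "\<dots> = (\<Sum>\<phi>\<in>(V - {r}) \<rightarrow>\<^sub>E V. (\<Prod>v\<in>V - {r}. c v (\<phi> v)) * Determinant.det (lap (parent_weight \<phi>)))"
    unfolding det_def'[OF lap_carrier] sum_distrib_left by (rule sum.swap)
  finally show ?thesis .
qed

text \<open>In \<open>det_lap\<close> only parent maps have a nonzero determinant, namely 1, and
  those that use a pair outside \<open>E\<close> have weight 0.\<close>

lemma matrix_tree:
  fixes w :: "'a set \<Rightarrow> 'b :: field"
  assumes c: "\<And>u v. c v u = (if {v, u} \<in> E then w {v, u} else 0)"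
  shows "Determinant.det (lap c) = (\<Sum>T\<in>spanning_trees V E. \<Prod>e\<in>T. w e)"
proof -
  let ?P = "(V - {r}) \<rightarrow>\<^sub>E V" and ?Q = "{\<phi>. parent_map V r \<phi> \<and> tree_of V r \<phi> \<subseteq> E}"
  have fin: "finite ?P"
    using finite_V by (intro finite_PiE) auto
  have Q: "?Q \<subseteq> ?P"
    unfolding parent_map_def by auto
  have "Determinant.det (lap c) = (\<Sum>\<phi>\<in>?P. (\<Prod>v\<in>V - {r}. c v (\<phi> v)) * Determinant.det (lap (parent_weight \<phi>)))"
    by (rule det_lap)
  also have "\<dots> = (\<Sum>\<phi>\<in>?Q. (\<Prod>v\<in>V - {r}. c v (\<phi> v)) * Determinant.det (lap (parent_weight \<phi>)))"
  proof (rule sum.mono_neutral_right[OF fin Q], rule ballI)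
    fix \<phi> assume \<phi>: "\<phi> \<in> ?P - ?Q"
    show "(\<Prod>v\<in>V - {r}. c v (\<phi> v)) * Determinant.det (lap (parent_weight \<phi>)) = 0"
    proof (cases "parent_map V r \<phi>")
      case True
      with \<phi> obtain v where "v \<in> V - {r}" "{v, \<phi> v} \<notin> E"
        unfolding tree_of_def by auto
      then have "(\<Prod>v\<in>V - {r}. c v (\<phi> v)) = 0"
        using finite_V c by (intro prod_zero) auto
      then show ?thesis by simp
    qed (use \<phi> det_lap_not_parent_map in auto)
  qed
  also have "\<dots> = (\<Sum>\<phi>\<in>?Q. \<Prod>e\<in>tree_of V r \<phi>. w e)"
  proof (rule sum.cong[OF refl])
    fix \<phi> assume \<phi>: "\<phi> \<in> ?Q"
    then have "(\<Prod>v\<in>V - {r}. c v (\<phi> v)) = (\<Prod>v\<in>V - {r}. w {v, \<phi> v})"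
      using c unfolding tree_of_def by (intro prod.cong) auto
    also have "\<dots> = (\<Prod>e\<in>tree_of V r \<phi>. w e)"
      unfolding tree_of_def using \<phi> inj_on_parent_edge by (subst prod.reindex) auto
    finally show "(\<Prod>v\<in>V - {r}. c v (\<phi> v)) * Determinant.det (lap (parent_weight \<phi>)) = (\<Prod>e\<in>tree_of V r \<phi>. w e)"
      using \<phi> det_lap_parent_map by auto
  qed
  also have "\<dots> = (\<Sum>T\<in>spanning_trees V E. \<Prod>e\<in>T. w e)"
    by (rule sum.reindex_bij_betw[OF bij_betw_tree_of[OF finite_V r_in]])
  finally show ?thesis .
qed

end

text \<open>A vanishing tree sum makes the reduced Laplacian singular; the kernel vector is extended
  by 0 to the root. This serves both to exclude zeros and, at a known zero, to produce a
  potential.\<close>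

lemma harmonic_of_tree_sum_zero:
  fixes w :: "'a set \<Rightarrow> 'b :: field"
  assumes "finite V" "r \<in> V" and zero: "(\<Sum>T\<in>spanning_trees V E. \<Prod>e\<in>T. w e) = 0"
  obtains x where "x r = 0" "\<exists>v\<in>V. x v \<noteq> 0"
    "\<forall>v\<in>V - {r}. (\<Sum>u\<in>V. (if {v, u} \<in> E then w {v, u} else 0) * (x v - x u)) = 0"
proof -
  define n where "n = card (V - {r})"
  obtain ix where "bij_betw ix {0..<n} (V - {r})"
    using ex_bij_betw_nat_finite[of "V - {r}"] assms(1) unfolding n_def by auto
  then interpret indexed_vertices V r n ix
    using assms by unfold_locales
  define c where "c v u = (if {v, u} \<in> E then w {v, u} else 0)" for v u
  have "Determinant.det (lap c) = 0"
    using matrix_tree[of c E w] zero unfolding c_def by simp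
  then obtain y where y: "y \<in> carrier_vec n" "y \<noteq> 0\<^sub>v n" "lap c *\<^sub>v y = 0\<^sub>v n"
    using det_0_iff_vec_prod_zero_field[OF lap_carrier] by blast
  define x where "x v = (if v \<in> V - {r} then y $ jx v else 0)" for v
  have xr: "x r = 0" and xi: "x (ix i) = y $ i" if "i < n" for i
    using ix_in jx_ix that unfolding x_def by auto
  show ?thesis
  proof (rule that)
    show "x r = 0" unfolding x_def by simp
    have "\<exists>i<n. y $ i \<noteq> 0"
    proof (rule ccontr)
      assume "\<not> (\<exists>i<n. y $ i \<noteq> 0)"
      with y(1) have "y = 0\<^sub>v n" by (intro eq_vecI) auto
      with y(2) show False ..
    qed
    then show "\<exists>v\<in>V. x v \<noteq> 0"
      using xi ix_in by (metis DiffD1)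
    show "\<forall>v\<in>V - {r}. (\<Sum>u\<in>V. (if {v, u} \<in> E then w {v, u} else 0) * (x v - x u)) = 0"
    proof
      fix v assume v: "v \<in> V - {r}"
      have "(lap c *\<^sub>v y) $ jx v = (\<Sum>u\<in>V. c (ix (jx v)) u * (x (ix (jx v)) - x u))"
        using y(1) xi jx_less[OF v] by (intro lap_mult_vec) (auto simp: x_def)
      then show "(\<Sum>u\<in>V. (if {v, u} \<in> E then w {v, u} else 0) * (x v - x u)) = 0"
        unfolding y(3) ix_jx[OF v] c_def using jx_less[OF v] by simp
    qed
  qed
qed

section \<open>Distributions with a stable generating function\<close>

definition avg :: "'b set \<Rightarrow> ('b \<Rightarrow> real) \<Rightarrow> real" where
  "avg S h = (\<Sum>t\<in>S. h t) / real (card S)"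

lemma avg_add: "avg S (\<lambda>t. f t + g t) = avg S f + avg S g"
  unfolding avg_def by (simp add: sum.distrib add_divide_distrib)

lemma avg_diff: "avg S (\<lambda>t. f t - g t) = avg S f - avg S g"
  unfolding avg_def by (simp add: sum_subtractf diff_divide_distrib)

lemma avg_cmult: "avg S (\<lambda>t. c * f t) = c * avg S f"
  unfolding avg_def by (simp add: sum_distrib_left[symmetric])

lemma avg_sum: "avg S (\<lambda>t. \<Sum>i\<in>I. f i t) = (\<Sum>i\<in>I. avg S (f i))"
  unfolding avg_def by (subst sum.swap) (simp add: sum_divide_distrib)

lemma avg_const: "finite S \<Longrightarrow> S \<noteq> {} \<Longrightarrow> avg S (\<lambda>_. c) = c"
  unfolding avg_def by simp

lemma avg_mono: "(\<And>t. t \<in> S \<Longrightarrow> f t \<le> g t) \<Longrightarrow> avg S f \<le> avg S g"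
  unfolding avg_def by (intro divide_right_mono sum_mono) auto

lemma avg_cong: "(\<And>t. t \<in> S \<Longrightarrow> f t = g t) \<Longrightarrow> avg S f = avg S g"
  unfolding avg_def by simp

text \<open>All roots of the generating polynomial lie in \<open>(-\<infinity>, 0]\<close>. A root
  \<open>x\<close> contributes the normalised factor \<open>(z - x) / (1 - x)\<close>, which is the
  generating function of a Bernoulli variable with parameter \<open>1 / (1 - x)\<close>.\<close>

lemma stable_pgf_factors:
  fixes X :: "'b \<Rightarrow> nat"
  assumes "finite S" "S \<noteq> {}"
    and stable: "\<And>z::complex. Im z \<noteq> 0 \<or> Re z > 0 \<Longrightarrow> (\<Sum>t\<in>S. z ^ X t) \<noteq> 0"
  obtains ls where "set ls \<subseteq> {0..1}" "\<And>z::real. avg S (\<lambda>t. z ^ X t) = (\<Prod>l\<leftarrow>ls. 1 - l + l * z)"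
proof -
  define p :: "complex poly" where "p = (\<Sum>t\<in>S. monom 1 (X t))"
  have p: "poly p z = (\<Sum>t\<in>S. z ^ X t)" for z
    unfolding p_def by (simp add: poly_sum poly_monom)
  obtain rs where rs: "mset rs = proots p"
    using ex_mset by blast
  have dec: "poly p z = lead_coeff p * (\<Prod>x\<leftarrow>rs. z - x)" for z
  proof -
    have "p = Polynomial.smult (lead_coeff p) (\<Prod>x\<leftarrow>rs. [:-x, 1:])"
      using complex_poly_decompose_multiset[of p] unfolding rs[symmetric]
      by (metis mset_map prod_mset_prod_list)
    then have "poly p z = poly (Polynomial.smult (lead_coeff p) (\<Prod>x\<leftarrow>rs. [:-x, 1:])) z" by simp
    also have "\<dots> = lead_coeff p * (\<Prod>x\<leftarrow>rs. z - x)"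
      by (induction rs) (auto simp: algebra_simps)
    finally show ?thesis .
  qed
  have p1: "poly p 1 = of_nat (card S)" using p[of 1] by simp
  then have nz: "poly p 1 \<noteq> 0" using assms(1,2) by simp
  have root: "Im x = 0" "Re x \<le> 0" if "x \<in> set rs" for x
  proof -
    have "(\<Prod>y\<leftarrow>rs. x - y) = 0"
      using that by (auto simp: prod_list_zero_iff)
    then have "(\<Sum>t\<in>S. x ^ X t) = 0"
      using dec[of x] p[of x] by simp
    then have "\<not> (Im x \<noteq> 0 \<or> Re x > 0)"
      using stable[of x] by blast
    then show "Im x = 0" "Re x \<le> 0" by auto
  qed
  define ls where "ls = map (\<lambda>x. 1 / (1 - Re x)) rs"
  have "avg S (\<lambda>t. z ^ X t) = (\<Prod>l\<leftarrow>ls. 1 - l + l * z)" for z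
  proof -
    have "complex_of_real (avg S (\<lambda>t. z ^ X t)) = poly p z / poly p 1"
      unfolding p1 unfolding avg_def p by simp
    also have "\<dots> = (\<Prod>x\<leftarrow>rs. complex_of_real z - x) / (\<Prod>x\<leftarrow>rs. 1 - x)"
      using nz unfolding dec by simp
    also have "\<dots> = (\<Prod>l\<leftarrow>ls. 1 - of_real l + of_real l * of_real z)"
      using root unfolding ls_def
    proof (induction rs)
      case (Cons x rs)
      have x: "x = of_real (Re x)" "1 - Re x > 0"
        using Cons.prems(1,2)[of x] by (auto simp: complex_eq_iff)
      then have "1 - x \<noteq> 0"
        by (metis of_real_1 of_real_diff of_real_eq_0_iff less_irrefl)
      moreover have "complex_of_real (1 / (1 - Re x)) = 1 / (1 - x)"
        using x(1) by simp
      ultimately have "(of_real z - x) / (1 - x) =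
          1 - complex_of_real (1 / (1 - Re x)) + of_real (1 / (1 - Re x)) * of_real z"
      proof -
        assume ne: "1 - x \<noteq> 0" and eq: "complex_of_real (1 / (1 - Re x)) = 1 / (1 - x)"
        define a where "a = 1 / (1 - x)"
        have "a * (1 - x) = 1" using ne unfolding a_def by simp
        then have "a * (of_real z - x) = 1 - a + a * of_real z"
          by (simp add: algebra_simps)
        then show ?thesis unfolding eq unfolding a_def by simp
      qed
      then show ?case
        using Cons by (simp add: times_divide_times_eq[symmetric] del: of_real_divide)
    qed simp
    also have "\<dots> = of_real (\<Prod>l\<leftarrow>ls. 1 - l + l * z)"
      by (induction ls) auto
    finally show ?thesis by (simp only: of_real_eq_iff)
  qed
  moreover have "set ls \<subseteq> {0..1}"
    unfolding ls_def by (auto simp: divide_le_eq_1 dest!: root(2))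
  ultimately show ?thesis using that by blast
qed

lemma coeff_linear_power_low:
  "coeff ([:1, 1:] ^ k :: real poly) 0 = 1"
  "coeff ([:1, 1:] ^ k :: real poly) 1 = real k"
  "coeff ([:1, 1:] ^ k :: real poly) 2 = real k * (real k - 1) / 2"
proof (induction k)
  case (Suc k)
  { case 1 show ?case using Suc by simp }
  { case 2 show ?case using Suc by (simp add: coeff_pCons) }
  { case 3 show ?case using Suc by (simp add: coeff_pCons numeral_2_eq_2 field_simps) }
qed (auto simp: numeral_2_eq_2)

lemma coeff_linear_factors_low:
  fixes ls :: "real list"
  defines "P \<equiv> (\<Prod>l\<leftarrow>ls. [:1, l:])"
  shows "coeff P 0 = 1" "coeff P 1 = sum_list ls"
    "coeff P 2 = ((sum_list ls)\<^sup>2 - (\<Sum>l\<leftarrow>ls. l\<^sup>2)) / 2"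
  unfolding P_def
proof (induction ls)
  case (Cons l ls)
  { case 1 show ?case using Cons by simp }
  { case 2 show ?case using Cons by (simp add: coeff_pCons) }
  { case 3 show ?case using Cons by (simp add: coeff_pCons numeral_2_eq_2 field_simps) }
qed (auto simp: numeral_2_eq_2)

text \<open>Substitute \<open>z = 1 + y\<close> and compare the coefficients of \<open>y\<close> and
  of its square: on the left these are the first two binomial moments of \<open>X\<close>, on the
  right elementary symmetric functions of \<open>ls\<close>.\<close>

lemma pgf_factor_moments:
  fixes X :: "'b \<Rightarrow> nat"
  assumes "\<And>z::real. avg S (\<lambda>t. z ^ X t) = (\<Prod>l\<leftarrow>ls. 1 - l + l * z)"
  shows "avg S (\<lambda>t. real (X t)) = sum_list ls"
    and "(\<Sum>l\<leftarrow>ls. l\<^sup>2) = avg S (\<lambda>t. real (X t)) - avg S (\<lambda>t. (real (X t))\<^sup>2) + (avg S (\<lambda>t. real (X t)))\<^sup>2"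
proof -
  define P where "P = (\<Sum>t\<in>S. Polynomial.smult (1 / real (card S)) ([:1, 1:] ^ X t))"
  have "poly P y = poly (\<Prod>l\<leftarrow>ls. [:1, l:]) y" for y
  proof -
    have "poly P y = avg S (\<lambda>t. (1 + y) ^ X t)"
      unfolding P_def avg_def by (simp add: poly_sum sum_divide_distrib)
    also have "\<dots> = (\<Prod>l\<leftarrow>ls. 1 - l + l * (1 + y))" by (rule assms)
    also have "\<dots> = poly (\<Prod>l\<leftarrow>ls. [:1, l:]) y"
      by (induction ls) (auto simp: algebra_simps)
    finally show ?thesis .
  qed
  then have P: "P = (\<Prod>l\<leftarrow>ls. [:1, l:])"
    by (simp add: poly_eq_poly_eq_iff[symmetric] fun_eq_iff)
  have c1: "coeff P 1 = avg S (\<lambda>t. real (X t))"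
    unfolding P_def avg_def coeff_sum coeff_smult coeff_linear_power_low by (simp add: sum_divide_distrib)
  then show m: "avg S (\<lambda>t. real (X t)) = sum_list ls"
    unfolding P coeff_linear_factors_low by simp
  have "2 * coeff P 2 = avg S (\<lambda>t. real (X t) * (real (X t) - 1))"
    unfolding P_def avg_def coeff_sum coeff_smult coeff_linear_power_low
    by (simp add: sum_divide_distrib sum_distrib_left)
  also have "\<dots> = avg S (\<lambda>t. (real (X t))\<^sup>2) - avg S (\<lambda>t. real (X t))"
    by (simp add: avg_diff[symmetric] power2_eq_square algebra_simps)
  finally show "(\<Sum>l\<leftarrow>ls. l\<^sup>2) = avg S (\<lambda>t. real (X t)) - avg S (\<lambda>t. (real (X t))\<^sup>2) + (avg S (\<lambda>t. real (X t)))\<^sup>2"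
    unfolding P coeff_linear_factors_low m by simp
qed

lemma exp_minus_le_quadratic:
  fixes y :: real
  assumes "0 \<le> y"
  shows "exp (- y) \<le> 1 - y + y\<^sup>2 / 2"
proof -
  have pos: "0 < 1 - y + y\<^sup>2 / 2"
    using zero_le_power2[of "y - 1"] by (simp add: power2_diff)
  \<comment> \<open>The product equals \<open>1 + y^4 / 4\<close>.\<close>
  have "1 \<le> (1 - y + y\<^sup>2 / 2) * (1 + y + y\<^sup>2 / 2)"
    using assms by (simp add: algebra_simps power2_eq_square)
  also have "\<dots> \<le> (1 - y + y\<^sup>2 / 2) * exp y"
    using exp_lower_Taylor_quadratic[OF assms] pos by (intro mult_left_mono) auto
  finally show ?thesis
    by (simp add: exp_minus field_simps)
qed

text \<open>Each factor is \<open>1 - y\<close> with \<open>y = (1 - x) * l\<close>, which lies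
  below \<open>exp (- y)\<close> by at most \<open>l^2 / 2\<close>. The errors only add up because
  all other factors are in \<open>[0, 1]\<close>. The five claims are proved in one induction, as
  the third uses the others.\<close>

lemma prod_linear_factors_bounds:
  fixes x :: real
  assumes "set ls \<subseteq> {0..1}" "0 \<le> x" "x \<le> 1"
  shows "0 \<le> (\<Prod>l\<leftarrow>ls. 1 - l + l * x)"
    and "(\<Prod>l\<leftarrow>ls. 1 - l + l * x) \<le> exp (- (1 - x) * sum_list ls)"
    and "exp (- (1 - x) * sum_list ls) - (\<Sum>l\<leftarrow>ls. l\<^sup>2) / 2 \<le> (\<Prod>l\<leftarrow>ls. 1 - l + l * x)"
    and "0 \<le> sum_list ls"
    and "0 \<le> (\<Sum>l\<leftarrow>ls. l\<^sup>2)"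
proof -
  have "0 \<le> (\<Prod>l\<leftarrow>ls. 1 - l + l * x) \<and>
    (\<Prod>l\<leftarrow>ls. 1 - l + l * x) \<le> exp (- (1 - x) * sum_list ls) \<and>
    exp (- (1 - x) * sum_list ls) - (\<Sum>l\<leftarrow>ls. l\<^sup>2) / 2 \<le> (\<Prod>l\<leftarrow>ls. 1 - l + l * x) \<and>
    0 \<le> sum_list ls \<and> 0 \<le> (\<Sum>l\<leftarrow>ls. l\<^sup>2)"
    using assms(1)
  proof (induction ls)
    case (Cons l ls)
    define y where "y = (1 - x) * l"
    define P where "P = (\<Prod>l\<leftarrow>ls. 1 - l + l * x)"
    define R where "R = exp (- (1 - x) * sum_list ls)"
    define q where "q = (\<Sum>l\<leftarrow>ls. l\<^sup>2)"
    have l: "0 \<le> l" "l \<le> 1" and sub: "set ls \<subseteq> {0..1}" using Cons.prems by auto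
    have IH: "0 \<le> P" "P \<le> R" "R - q / 2 \<le> P" "0 \<le> sum_list ls" "0 \<le> q"
      using Cons.IH[OF sub] unfolding P_def R_def q_def by auto
    have y: "0 \<le> y" "y \<le> 1" "y \<le> l"
      using l assms(2,3) unfolding y_def by (auto simp: mult_le_one mult_left_le_one_le)
    have a: "1 - l + l * x = 1 - y" unfolding y_def by (simp add: algebra_simps)
    have e: "exp (- (1 - x) * (l + sum_list ls)) = exp (- y) * R"
      unfolding y_def R_def by (simp add: exp_add[symmetric] algebra_simps)
    have R: "0 \<le> R" "R \<le> 1"
      using IH(4) assms(3) unfolding R_def by (auto simp: mult_nonpos_nonneg)
    have "(1 - y) * P \<le> exp (- y) * R"
      using IH(1,2) y exp_ge_add_one_self[of "- y"] by (intro mult_mono) auto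
    moreover have "exp (- y) * R - (l\<^sup>2 + q) / 2 \<le> (1 - y) * P"
    proof -
      have "y\<^sup>2 \<le> l\<^sup>2" using y by (intro power_mono) auto
      then have "exp (- y) - l\<^sup>2 / 2 \<le> 1 - y"
        using exp_minus_le_quadratic[OF y(1)] by linarith
      then have "(exp (- y) - l\<^sup>2 / 2) * R \<le> (1 - y) * R"
        using R by (intro mult_right_mono) auto
      moreover have "l\<^sup>2 / 2 * R \<le> l\<^sup>2 / 2"
        using R by (intro mult_left_le) auto
      moreover have "(1 - y) * (R - q / 2) \<le> (1 - y) * P"
        using IH(3) y by (intro mult_left_mono) auto
      moreover have "(1 - y) * (q / 2) \<le> q / 2"
        using IH(5) y by (intro mult_left_le_one_le) auto
      moreover have "(l\<^sup>2 + q) / 2 = l\<^sup>2 / 2 + q / 2" by (rule add_divide_distrib)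
      ultimately show ?thesis
        unfolding left_diff_distrib right_diff_distrib by linarith
    qed
    moreover have "0 \<le> (1 - y) * P" using IH(1) y by simp
    ultimately show ?case
      using e IH(4,5) l unfolding list.map prod_list.Cons sum_list.Cons a P_def[symmetric] q_def[symmetric]
      by auto
  qed auto
  then show "0 \<le> (\<Prod>l\<leftarrow>ls. 1 - l + l * x)"
    "(\<Prod>l\<leftarrow>ls. 1 - l + l * x) \<le> exp (- (1 - x) * sum_list ls)"
    "exp (- (1 - x) * sum_list ls) - (\<Sum>l\<leftarrow>ls. l\<^sup>2) / 2 \<le> (\<Prod>l\<leftarrow>ls. 1 - l + l * x)"
    "0 \<le> sum_list ls" "0 \<le> (\<Sum>l\<leftarrow>ls. l\<^sup>2)"
    by auto
qed

text \<open>
  \<open>X\<close> has the law of a sum of independent Bernoulli variables with parameters \<open>l\<close>,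
  and \<open>mean - variance\<close> is the sum of the \<open>l\<^sup>2\<close>.
\<close>

lemma stable_pgf_bounds:
  fixes X :: "'b \<Rightarrow> nat" and x :: real
  assumes "finite S" "S \<noteq> {}"
    and "\<And>z::complex. Im z \<noteq> 0 \<or> Re z > 0 \<Longrightarrow> (\<Sum>t\<in>S. z ^ X t) \<noteq> 0"
    and x: "0 \<le> x" "x \<le> 1"
  defines "m \<equiv> avg S (\<lambda>t. real (X t))"
  defines "q \<equiv> m - avg S (\<lambda>t. (real (X t))\<^sup>2) + m\<^sup>2"
  shows "avg S (\<lambda>t. x ^ X t) \<le> exp (- (1 - x) * m)"
    and "exp (- (1 - x) * m) - q / 2 \<le> avg S (\<lambda>t. x ^ X t)"
    and "0 \<le> q"
proof -
  obtain ls where ls: "set ls \<subseteq> {0..1}" "\<And>z::real. avg S (\<lambda>t. z ^ X t) = (\<Prod>l\<leftarrow>ls. 1 - l + l * z)"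
    using stable_pgf_factors[OF assms(1-3)] by blast
  have m: "m = sum_list ls" and q: "q = (\<Sum>l\<leftarrow>ls. l\<^sup>2)"
    using pgf_factor_moments[OF ls(2)] unfolding m_def q_def by auto
  show "avg S (\<lambda>t. x ^ X t) \<le> exp (- (1 - x) * m)"
    "exp (- (1 - x) * m) - q / 2 \<le> avg S (\<lambda>t. x ^ X t)" "0 \<le> q"
    using prod_linear_factors_bounds[OF ls(1) x] unfolding m q ls(2) by auto
qed

section \<open>Consequences for the uniform spanning tree\<close>

text \<open>Summation by parts: exchange the two indices, which symmetry of \<open>c\<close> allows,
  and add the two forms of the sum.\<close>

lemma sum_dirichlet:
  fixes c :: "'a \<Rightarrow> 'a \<Rightarrow> 'b :: comm_ring_1"
  assumes "\<And>u v. c u v = c v u"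
  shows "2 * (\<Sum>v\<in>V. y v * (\<Sum>u\<in>V. c v u * (x v - x u))) = (\<Sum>v\<in>V. \<Sum>u\<in>V. c v u * ((y v - y u) * (x v - x u)))"
proof -
  have "(\<Sum>v\<in>V. \<Sum>u\<in>V. c v u * (y u * (x u - x v))) = (\<Sum>v\<in>V. \<Sum>u\<in>V. c v u * (y v * (x v - x u)))"
    by (subst sum.swap) (simp add: assms)
  moreover have "(\<Sum>v\<in>V. y v * (\<Sum>u\<in>V. c v u * (x v - x u))) = (\<Sum>v\<in>V. \<Sum>u\<in>V. c v u * (y v * (x v - x u)))"
    by (simp add: sum_distrib_left mult_ac)
  ultimately have "2 * (\<Sum>v\<in>V. y v * (\<Sum>u\<in>V. c v u * (x v - x u))) =
      (\<Sum>v\<in>V. \<Sum>u\<in>V. c v u * (y v * (x v - x u))) + (\<Sum>v\<in>V. \<Sum>u\<in>V. c v u * (y u * (x u - x v)))"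
    by simp
  also have "\<dots> = (\<Sum>v\<in>V. \<Sum>u\<in>V. c v u * ((y v - y u) * (x v - x u)))"
    unfolding sum.distrib[symmetric] by (intro sum.cong) (auto simp: algebra_simps)
  finally show ?thesis .
qed

lemma quadratic_nonreal_root:
  fixes A B C :: real
  assumes "B\<^sup>2 < 4 * A * C"
  shows "\<exists>z::complex. Im z \<noteq> 0 \<and> of_real A * z\<^sup>2 + of_real B * z + of_real C = 0"
proof -
  have A: "A \<noteq> 0" using assms by (auto simp: not_less)
  define D where "D = sqrt (4 * A * C - B\<^sup>2)"
  have D: "D\<^sup>2 = 4 * A * C - B\<^sup>2" "D \<noteq> 0"
    using assms unfolding D_def by auto
  define z where "z = Complex (- B / (2 * A)) (D / (2 * A))"
  have re: "4 * A\<^sup>2 * ((Re z)\<^sup>2 - (Im z)\<^sup>2) = B\<^sup>2 - D\<^sup>2"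
    using A unfolding z_def by (simp add: power_divide field_simps)
  have "2 * A * Re z = - B" using A unfolding z_def by simp
  then have "2 * B * (2 * A * Re z) = 2 * B * (- B)" by simp
  then have "4 * A * (A * ((Re z)\<^sup>2 - (Im z)\<^sup>2) + B * Re z + C) = B\<^sup>2 - D\<^sup>2 + 2 * B * (- B) + 4 * A * C"
    using re by (simp add: algebra_simps power2_eq_square)
  also have "\<dots> = 0" using D(1) by (simp add: power2_eq_square)
  finally have "A * ((Re z)\<^sup>2 - (Im z)\<^sup>2) + B * Re z + C = 0" using A by simp
  moreover have "2 * A * Re z * Im z + B * Im z = 0"
    using A unfolding z_def by simp
  ultimately have "of_real A * z\<^sup>2 + of_real B * z + of_real C = 0"
    by (simp add: complex_eq_iff power2_eq_square algebra_simps)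
  moreover have "Im z \<noteq> 0" using A D(2) unfolding z_def by simp
  ultimately show ?thesis by blast
qed

locale connected_simple_graph =
  fixes V :: "'a set" and E :: "'a set set"
  assumes simple: "finite_simple_graph V E" and connected: "connected_graph V E"
begin

abbreviation trees :: "'a set set set" where "trees \<equiv> spanning_trees V E"

lemma finite_V: "finite V"
  using simple unfolding finite_simple_graph_def by blast

lemma V_nonempty: "V \<noteq> {}"
  using connected unfolding connected_graph_def by blast

lemma finite_E: "finite E"
  using finite_edges[OF simple] .

lemma finite_trees: "finite trees"
  using finite_E unfolding spanning_trees_def by (auto intro: finite_subset[of _ "Pow E"])

lemma treeD:
  assumes "T \<in> trees"
  shows "T \<subseteq> E" "finite T" "finite_simple_graph V T" "connected_graph V T"
  using assms finite_E unfolding spanning_trees_def tree_on_def by (auto intro: finite_subset)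

lemma edge_subset: "e \<in> E \<Longrightarrow> e \<subseteq> V" and card_edge: "e \<in> E \<Longrightarrow> card e = 2"
  using simple unfolding finite_simple_graph_def by auto

lemma singleton_notin: "{v} \<notin> E"
  using card_edge[of "{v}"] by auto

lemma constant_on_edges:
  assumes "\<And>u v. {u, v} \<in> E \<Longrightarrow> x u = x v" "u \<in> V" "v \<in> V"
  shows "x u = x v"
proof -
  have "(u, v) \<in> {(a, b). {a, b} \<in> E}\<^sup>*"
    using connected assms unfolding connected_graph_def by blast
  then show ?thesis
    by (induction rule: rtrancl_induct) (auto dest: assms(1))
qed

text \<open>At a zero there is a kernel vector \<open>x\<close>. Pairing its Laplacian with the
  conjugate of \<open>x\<close> gives \<open>a + z * b = 0\<close>, where \<open>a\<close> and
  \<open>b\<close> are the nonnegative Dirichlet energies off and on \<open>A\<close>. As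
  \<open>z\<close> avoids \<open>(-\<infinity>, 0]\<close>, both vanish, so \<open>x\<close> is
  constant by connectedness and equals its value 0 at the root.\<close>

lemma tree_sum_nonzero:
  fixes c :: "'a set \<Rightarrow> real" and z :: complex
  assumes c: "\<And>e. e \<in> E \<Longrightarrow> 0 < c e" and z: "Im z \<noteq> 0 \<or> Re z > 0"
  shows "(\<Sum>T\<in>trees. \<Prod>e\<in>T. of_real (c e) * (if e \<in> A then z else 1)) \<noteq> 0"
proof
  let ?w = "\<lambda>e. of_real (c e) * (if e \<in> A then z else 1)"
  assume zero: "(\<Sum>T\<in>trees. \<Prod>e\<in>T. ?w e) = 0"
  obtain r where r: "r \<in> V" using V_nonempty by blast
  obtain x where x: "x r = 0" "\<exists>v\<in>V. x v \<noteq> 0"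
    "\<forall>v\<in>V - {r}. (\<Sum>u\<in>V. (if {v, u} \<in> E then ?w {v, u} else 0) * (x v - x u)) = 0"
    by (rule harmonic_of_tree_sum_zero[OF finite_V r zero])
  let ?c = "\<lambda>v u. if {v, u} \<in> E then ?w {v, u} else 0"
  define g where "g v u = (if {v, u} \<in> E then c {v, u} * (cmod (x v - x u))\<^sup>2 else 0)" for v u
  define a where "a = (\<Sum>v\<in>V. \<Sum>u\<in>V. if {v, u} \<in> A then 0 else g v u)"
  define b where "b = (\<Sum>v\<in>V. \<Sum>u\<in>V. if {v, u} \<in> A then g v u else 0)"
  have g: "0 \<le> g v u" for v u
    using c[of "{v, u}"] unfolding g_def by auto
  have a0: "0 \<le> a" and b0: "0 \<le> b"
    unfolding a_def b_def using g by (auto intro!: sum_nonneg)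
  \<comment> \<open>The kernel equations omit the row of the root; that row drops out because
    \<open>x r = 0\<close>.\<close>
  have "cnj (x v) * (\<Sum>u\<in>V. ?c v u * (x v - x u)) = 0" if "v \<in> V" for v
    using x(1) x(3) that by (cases "v = r") auto
  then have "0 = 2 * (\<Sum>v\<in>V. cnj (x v) * (\<Sum>u\<in>V. ?c v u * (x v - x u)))"
    by (simp add: sum.neutral del: mult_eq_0_iff)
  also have "\<dots> = (\<Sum>v\<in>V. \<Sum>u\<in>V. ?c v u * ((cnj (x v) - cnj (x u)) * (x v - x u)))"
    by (rule sum_dirichlet) (simp add: insert_commute)
  also have "\<dots> = (\<Sum>v\<in>V. \<Sum>u\<in>V. of_real (if {v, u} \<in> A then 0 else g v u) + z * of_real (if {v, u} \<in> A then g v u else 0))"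
  proof (intro sum.cong refl)
    fix v u
    have "(cnj (x v) - cnj (x u)) * (x v - x u) = complex_of_real ((cmod (x v - x u))\<^sup>2)"
      by (metis complex_cnj_diff complex_norm_square mult.commute)
    then show "?c v u * ((cnj (x v) - cnj (x u)) * (x v - x u)) =
        of_real (if {v, u} \<in> A then 0 else g v u) + z * of_real (if {v, u} \<in> A then g v u else 0)"
      unfolding g_def by simp
  qed
  also have "\<dots> = of_real a + z * of_real b"
    unfolding a_def b_def by (simp add: sum.distrib sum_distrib_left)
  finally have eq: "of_real a + z * of_real b = 0" by simp
  have "Im z * b = 0" "a + Re z * b = 0"
    using arg_cong[OF eq, of Im] arg_cong[OF eq, of Re] by auto
  then have "a = 0" "b = 0"
    using z a0 b0 by (auto simp: add_nonneg_eq_0_iff)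
  then have "a + b = 0" by simp
  then have "(\<Sum>v\<in>V. \<Sum>u\<in>V. g v u) = 0"
    unfolding a_def b_def sum.distrib[symmetric] by (simp add: if_distrib cong: if_cong)
  then have "g v u = 0" if "v \<in> V" "u \<in> V" for v u
    using g that finite_V by (simp add: sum_nonneg_eq_0_iff sum_nonneg)
  then have "x v = x u" if "{v, u} \<in> E" for v u
    using that c[of "{v, u}"] edge_subset[of "{v, u}"] unfolding g_def by force
  then have "x v = x r" if "v \<in> V" for v
    using constant_on_edges[of x] r that by blast
  with x(1,2) show False by auto
qed

text \<open>Without spanning trees the tree sum would be the empty sum 0.\<close>

lemma trees_nonempty: "trees \<noteq> {}"
  using tree_sum_nonzero[of "\<lambda>_. 1" 1 "{}"] by auto

lemma card_tree: "T \<in> trees \<Longrightarrow> card T = card V - 1"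
  using card_spanning_tree[OF finite_V V_nonempty] .

lemma prod_tree_power:
  fixes z :: "'b :: comm_monoid_mult"
  shows "T \<in> trees \<Longrightarrow> (\<Prod>e\<in>T. if e \<in> A then z else 1) = z ^ card (T \<inter> A)"
  using treeD(2) by (simp add: prod.If_cases)

text \<open>The shift by \<open>m\<close> divides the trivial factor \<open>z\<^sup>m\<close> out of the generating function.\<close>

lemma stable_edge_count:
  fixes z :: complex
  assumes m: "\<And>T. T \<in> trees \<Longrightarrow> m \<le> card (T \<inter> A)" and z: "Im z \<noteq> 0 \<or> Re z > 0"
  shows "(\<Sum>T\<in>trees. z ^ (card (T \<inter> A) - m)) \<noteq> 0"
proof
  assume zero: "(\<Sum>T\<in>trees. z ^ (card (T \<inter> A) - m)) = 0"
  have "(\<Sum>T\<in>trees. \<Prod>e\<in>T. of_real 1 * (if e \<in> A then z else 1)) = (\<Sum>T\<in>trees. z ^ m * z ^ (card (T \<inter> A) - m))"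
    using m by (intro sum.cong) (auto simp: prod_tree_power simp flip: power_add)
  also have "\<dots> = 0"
    using zero by (simp flip: sum_distrib_left)
  finally show False
    using tree_sum_nonzero[of "\<lambda>_. 1" z A] z by simp
qed

definition edge_prob :: "'a set \<Rightarrow> real" where
  "edge_prob e = avg trees (\<lambda>T. of_bool (e \<in> T))"

lemma edge_prob_bounds: "0 \<le> edge_prob e" "edge_prob e \<le> 1"
proof -
  have "avg trees (\<lambda>T. 0) \<le> edge_prob e" "edge_prob e \<le> avg trees (\<lambda>T. 1)"
    unfolding edge_prob_def by (intro avg_mono; simp)+
  then show "0 \<le> edge_prob e" "edge_prob e \<le> 1"
    by (simp_all add: avg_const finite_trees trees_nonempty)
qed

text \<open>Giving \<open>e\<close> and \<open>f\<close> the weights \<open>\<alpha> * z\<close> and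
  \<open>\<beta> * z\<close> turns the tree sum into a quadratic in \<open>z\<close>. It has no
  nonreal root, so its discriminant is nonnegative for all positive \<open>\<alpha>\<close>,
  \<open>\<beta>\<close>. A good choice of these gives \<open>N00 * N11 \<le> N10 * N01\<close>,
  which is negative correlation in terms of counts.\<close>

lemma negative_correlation:
  assumes ef: "e \<in> E" "f \<in> E" "e \<noteq> f"
  shows "avg trees (\<lambda>T. of_bool (e \<in> T) * of_bool (f \<in> T)) \<le> edge_prob e * edge_prob f"
proof -
  define N11 where "N11 = (\<Sum>T\<in>trees. of_bool (e \<in> T \<and> f \<in> T) :: real)"
  define N10 where "N10 = (\<Sum>T\<in>trees. of_bool (e \<in> T \<and> f \<notin> T) :: real)"
  define N01 where "N01 = (\<Sum>T\<in>trees. of_bool (e \<notin> T \<and> f \<in> T) :: real)"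
  define N00 where "N00 = (\<Sum>T\<in>trees. of_bool (e \<notin> T \<and> f \<notin> T) :: real)"
  have nonneg: "0 \<le> N11" "0 \<le> N10" "0 \<le> N01" "0 \<le> N00"
    unfolding N11_def N10_def N01_def N00_def by (auto intro!: sum_nonneg)
  have disc: "4 * (\<alpha> * \<beta> * N11) * N00 \<le> (\<alpha> * N10 + \<beta> * N01)\<^sup>2" if pos: "\<alpha> > 0" "\<beta> > 0" for \<alpha> \<beta>
  proof (rule ccontr)
    assume "\<not> ?thesis"
    then obtain z :: complex where z: "Im z \<noteq> 0"
      "of_real (\<alpha> * \<beta> * N11) * z\<^sup>2 + of_real (\<alpha> * N10 + \<beta> * N01) * z + of_real N00 = 0"
      using quadratic_nonreal_root[of "\<alpha> * N10 + \<beta> * N01" "\<alpha> * \<beta> * N11" N00] by (auto simp: not_le)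
    define c where "c g = (if g = e then \<alpha> else if g = f then \<beta> else 1)" for g
    have ob: "complex_of_real (of_bool P) = of_bool P" for P by (cases P) auto
    have "(\<Prod>g\<in>T. of_real (c g) * (if g \<in> {e, f} then z else 1)) =
        of_real (\<alpha> * \<beta>) * z\<^sup>2 * of_bool (e \<in> T \<and> f \<in> T) + of_real \<alpha> * z * of_bool (e \<in> T \<and> f \<notin> T)
        + of_real \<beta> * z * of_bool (e \<notin> T \<and> f \<in> T) + of_bool (e \<notin> T \<and> f \<notin> T)" if T: "T \<in> trees" for T
    proof -
      have "(\<Prod>g\<in>T. of_real (c g) * (if g \<in> {e, f} then z else 1)) =
          (\<Prod>g\<in>T. (if g = e then of_real \<alpha> * z else 1) * (if g = f then of_real \<beta> * z else 1))"
        using ef(3) by (intro prod.cong) (auto simp: c_def)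
      also have "\<dots> = (if e \<in> T then of_real \<alpha> * z else 1) * (if f \<in> T then of_real \<beta> * z else 1)"
        using treeD(2)[OF T] by (simp add: prod.distrib prod.delta)
      finally show ?thesis by (auto simp: power2_eq_square)
    qed
    then have "(\<Sum>T\<in>trees. \<Prod>g\<in>T. of_real (c g) * (if g \<in> {e, f} then z else 1)) =
        of_real (\<alpha> * \<beta> * N11) * z\<^sup>2 + of_real (\<alpha> * N10 + \<beta> * N01) * z + of_real N00"
      unfolding N11_def N10_def N01_def N00_def
      by (simp add: sum.distrib sum_distrib_left sum_distrib_right algebra_simps ob)
    moreover have "0 < c g" for g using pos unfolding c_def by auto
    ultimately show False
      using tree_sum_nonzero[of c z "{e, f}"] z by simp
  qed
  \<comment> \<open>Integrality bounds a nonzero count below by 1; this serves the degenerate case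
    \<open>N10 = 0 \<or> N01 = 0\<close>.\<close>
  have int: "N11 = 0 \<or> 1 \<le> N11" "N00 = 0 \<or> 1 \<le> N00"
    unfolding N11_def N00_def of_bool_def by (simp_all add: sum.If_cases finite_trees Suc_le_eq neq0_conv[symmetric] del: neq0_conv card_0_eq)
  have "N00 * N11 \<le> N10 * N01"
  proof (cases "N10 = 0 \<or> N01 = 0")
    case False
    then have "N10 > 0" "N01 > 0" using nonneg by auto
    \<comment> \<open>The choice \<open>\<alpha> = N01\<close>, \<open>\<beta> = N10\<close> makes
      both terms of the linear coefficient equal.\<close>
    from disc[OF this(2,1)] have "4 * (N01 * N10) * (N00 * N11) \<le> 4 * (N01 * N10) * (N10 * N01)"
      by (simp add: power2_eq_square algebra_simps)
    then show ?thesis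
      using \<open>N10 > 0\<close> \<open>N01 > 0\<close> by (simp add: mult_le_cancel_left)
  next
    case True
    have "N00 * N11 = 0"
    proof (rule ccontr)
      assume "N00 * N11 \<noteq> 0"
      have pos: "0 < y\<^sup>2 + 1" for y :: real
        by (simp add: add_nonneg_pos)
      from \<open>N00 * N11 \<noteq> 0\<close> have "1 \<le> N00 * N11"
        using int mult_mono[of 1 N00 1 N11] by auto
      \<comment> \<open>When one mixed count is 0, a large weight on one edge enters only the left
        side of \<open>disc\<close>, which then exceeds the right side.\<close>
      moreover have "4 * ((N01\<^sup>2 + 1) * (N00 * N11)) \<le> N01\<^sup>2" if "N10 = 0"
        using disc[of "N01\<^sup>2 + 1" 1] pos[of N01] that by (simp add: algebra_simps)
      moreover have "4 * ((N10\<^sup>2 + 1) * (N00 * N11)) \<le> N10\<^sup>2" if "N01 = 0"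
        using disc[of 1 "N10\<^sup>2 + 1"] pos[of N10] that by (simp add: algebra_simps)
      moreover have "s + 1 \<le> (s + 1) * (N00 * N11)" if "0 \<le> s" "1 \<le> N00 * N11" for s
        using that mult_left_mono[of 1 "N00 * N11" "s + 1"] by simp
      ultimately show False
        using True zero_le_power2[of N01] zero_le_power2[of N10] by (smt (verit))
    qed
    then show ?thesis using True by auto
  qed
  \<comment> \<open>Adding \<open>N11 * (N11 + N10 + N01)\<close> to both sides completes the
    products.\<close>
  then have ineq: "(N11 + N10 + N01 + N00) * N11 \<le> (N11 + N10) * (N11 + N01)"
    by (simp add: algebra_simps)
  define N where "N = real (card trees)"
  have N: "N = N11 + N10 + N01 + N00"
  proof -
    have "N = (\<Sum>T\<in>trees. of_bool (e \<in> T \<and> f \<in> T) + of_bool (e \<in> T \<and> f \<notin> T)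
        + of_bool (e \<notin> T \<and> f \<in> T) + of_bool (e \<notin> T \<and> f \<notin> T))"
      unfolding N_def real_of_card by (intro sum.cong) auto
    then show ?thesis
      unfolding N11_def N10_def N01_def N00_def by (simp only: sum.distrib)
  qed
  have pe: "edge_prob e = (N11 + N10) / N" and pf: "edge_prob f = (N11 + N01) / N"
    unfolding edge_prob_def avg_def N_def N11_def N10_def N01_def sum.distrib[symmetric]
    by (intro arg_cong2[of _ _ _ _ "(/)"] sum.cong refl; simp)+
  have pef: "avg trees (\<lambda>T. of_bool (e \<in> T) * of_bool (f \<in> T)) = N11 / N"
    unfolding avg_def N_def N11_def by (intro arg_cong2[of _ _ _ _ "(/)"] sum.cong refl) simp
  have "N > 0"
    unfolding N_def using finite_trees trees_nonempty by (simp add: card_gt_0_iff)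
  then have "N11 / N = N * N11 / (N * N)" by simp
  also have "\<dots> \<le> (N11 + N10) * (N11 + N01) / (N * N)"
    using ineq unfolding N[symmetric] by (intro divide_right_mono) auto
  finally show ?thesis unfolding pe pf pef by simp
qed

text \<open>The breadth-first tree rooted at an end of the edge contains the edge.\<close>

lemma edge_prob_pos:
  assumes "{a, r} \<in> E"
  shows "edge_prob {a, r} > 0"
proof -
  have r: "r \<in> V" using edge_subset[OF assms] by simp
  obtain \<phi> where \<phi>: "parent_map V r \<phi>" "tree_of V r \<phi> \<subseteq> E" "{a, r} \<in> tree_of V r \<phi>"
    by (rule bfs_parent_map[OF simple connected r]) (rule that, auto intro: assms)
  then have T: "tree_of V r \<phi> \<in> trees"
    using tree_on_tree_of[OF finite_V r] unfolding spanning_trees_def by blast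
  have "0 < (\<Sum>T\<in>trees. of_bool ({a, r} \<in> T) :: real)"
    using T \<phi>(3) finite_trees by (intro sum_pos2[of _ "tree_of V r \<phi>"]) auto
  then show ?thesis
    using finite_trees trees_nonempty unfolding edge_prob_def avg_def by (simp add: card_gt_0_iff)
qed

text \<open>
  \<open>p = edge_prob {a, b}\<close> is the effective resistance: lowering the weight of the edge to \<open>1 - 1/p\<close> makes
  the tree sum vanish, and the resulting kernel vector is the potential of a unit current.
  The bound is Dirichlet's principle for the test function \<open>f\<close>.
\<close>

lemma edge_prob_energy:
  fixes f :: "'a \<Rightarrow> real"
  assumes e: "{a, b} \<in> E"
  shows "2 * (f a - f b)\<^sup>2 \<le> edge_prob {a, b} * (\<Sum>v\<in>V. \<Sum>u\<in>V. of_bool ({v, u} \<in> E) * ((f v - f u) * (f v - f u)))"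
proof -
  define p where "p = edge_prob {a, b}"
  define s where "s = 1 / p"
  have p: "p > 0" unfolding p_def using edge_prob_pos[OF e] .
  then have s: "s > 0" unfolding s_def by simp
  have ab: "a \<in> V" "b \<in> V" "a \<noteq> b"
    using edge_subset[OF e] singleton_notin[of a] e by auto
  define w where "w g = (if g = {a, b} then 1 - s else 1)" for g
  have "(\<Sum>T\<in>trees. \<Prod>g\<in>T. w g) = (\<Sum>T\<in>trees. 1 - s * of_bool ({a, b} \<in> T))"
    using treeD(2) by (intro sum.cong) (auto simp: w_def prod.delta)
  also have "\<dots> = real (card trees) * avg trees (\<lambda>T. 1 - s * of_bool ({a, b} \<in> T))"
    unfolding avg_def using finite_trees trees_nonempty by simp
  also have "avg trees (\<lambda>T. 1 - s * of_bool ({a, b} \<in> T)) = 1 - s * p"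
    unfolding p_def edge_prob_def by (simp add: avg_diff avg_cmult avg_const finite_trees trees_nonempty)
  also have "1 - s * p = 0" using p unfolding s_def by simp
  finally have zero: "(\<Sum>T\<in>trees. \<Prod>g\<in>T. w g) = 0" by simp
  obtain x where x: "x a = 0" "\<exists>v\<in>V. x v \<noteq> 0"
    "\<forall>v\<in>V - {a}. (\<Sum>u\<in>V. (if {v, u} \<in> E then w {v, u} else 0) * (x v - x u)) = 0"
    by (rule harmonic_of_tree_sum_zero[OF finite_V ab(1) zero])
  define B where "B h k = (\<Sum>v\<in>V. \<Sum>u\<in>V. of_bool ({v, u} \<in> E) * ((h v - h u) * (k v - k u)))"
    for h k :: "'a \<Rightarrow> real"
  \<comment> \<open>The edge occurs as two ordered pairs, whence the factor 2.\<close>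
  have pick: "(\<Sum>v\<in>V. \<Sum>u\<in>V. of_bool ({v, u} = {a, b}) * ((h v - h u) * (k v - k u))) = 2 * ((h a - h b) * (k a - k b))"
    for h k :: "'a \<Rightarrow> real"
  proof -
    have "(\<Sum>v\<in>V. \<Sum>u\<in>V. of_bool ({v, u} = {a, b}) * ((h v - h u) * (k v - k u))) =
        (\<Sum>v\<in>V. \<Sum>u\<in>V. (if v = a then (if u = b then (h a - h b) * (k a - k b) else 0) else 0)
          + (if v = b then (if u = a then (h a - h b) * (k a - k b) else 0) else 0))"
      using ab(3) by (intro sum.cong refl) (auto simp: doubleton_eq_iff algebra_simps)
    also have "\<dots> = 2 * ((h a - h b) * (k a - k b))"
      using ab finite_V by (simp add: sum.distrib if_distrib[of "sum _"] sum.If_cases sum.delta cong: if_cong)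
    finally show ?thesis .
  qed
  \<comment> \<open>Subtracting the constant \<open>h a\<close> leaves all differences unchanged and
    removes the row of the root \<open>a\<close>. What remains of the pairing is the correction of
    weight \<open>- s\<close> on the edge \<open>{a, b}\<close>.\<close>
  have Bx: "B h x = 2 * s * ((h a - h b) * (x a - x b))" for h
  proof -
    define y where "y v = h v - h a" for v
    have "y v * (\<Sum>u\<in>V. (if {v, u} \<in> E then w {v, u} else 0) * (x v - x u)) = 0" if "v \<in> V" for v
      using x(3) that unfolding y_def by (cases "v = a") auto
    then have "0 = 2 * (\<Sum>v\<in>V. y v * (\<Sum>u\<in>V. (if {v, u} \<in> E then w {v, u} else 0) * (x v - x u)))"
      by (simp add: sum.neutral del: mult_eq_0_iff)
    also have "\<dots> = (\<Sum>v\<in>V. \<Sum>u\<in>V. (if {v, u} \<in> E then w {v, u} else 0) * ((y v - y u) * (x v - x u)))"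
      by (rule sum_dirichlet) (simp add: insert_commute)
    also have "\<dots> = (\<Sum>v\<in>V. \<Sum>u\<in>V. of_bool ({v, u} \<in> E) * ((h v - h u) * (x v - x u))
        - s * (of_bool ({v, u} = {a, b}) * ((h v - h u) * (x v - x u))))"
      using e by (intro sum.cong refl) (auto simp: w_def y_def algebra_simps)
    also have "\<dots> = B h x - s * (2 * ((h a - h b) * (x a - x b)))"
      unfolding B_def pick[symmetric] by (simp add: sum_subtractf sum_distrib_left)
    finally show ?thesis by simp
  qed
  \<comment> \<open>If \<open>X\<close> were 0, the energy of \<open>x\<close> would vanish and
    \<open>x\<close> would be constant, hence 0.\<close>
  define X where "X = x a - x b"
  have X: "X \<noteq> 0"
  proof
    assume "X = 0"
    then have "B x x = 0" using Bx[of x] unfolding X_def by simp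
    then have "of_bool ({v, u} \<in> E) * ((x v - x u) * (x v - x u)) = 0" if "v \<in> V" "u \<in> V" for v u
      using that finite_V unfolding B_def by (simp add: sum_nonneg_eq_0_iff sum_nonneg)
    then have "x v = x u" if "{v, u} \<in> E" for v u
      using that edge_subset[OF that] by auto
    then have "x v = x a" if "v \<in> V" for v
      using constant_on_edges[of x] ab(1) that by blast
    with x(1,2) show False by auto
  qed
  \<comment> \<open>By \<open>Bx\<close>, the factors \<open>B f x\<close> and \<open>B x x\<close>
    are explicit, so Cauchy-Schwarz becomes a lower bound for \<open>B f f\<close> after division by
    \<open>2 * s * X^2\<close>.\<close>
  have CS: "(B f x)\<^sup>2 \<le> B f f * B x x"
  proof -
    define D where "D h g = of_bool ({fst g, snd g} \<in> E) * (h (fst g) - h (snd g))" for h :: "'a \<Rightarrow> real" and g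
    have "B h k = (\<Sum>g\<in>V \<times> V. D h g * D k g)" for h k
      unfolding B_def D_def sum.cartesian_product by (intro sum.cong) auto
    then show ?thesis
      using Cauchy_Schwarz_ineq_sum[of "D f" "D x" "V \<times> V"] by (simp add: power2_eq_square)
  qed
  have "(2 * s * X\<^sup>2) * (2 * s * (f a - f b)\<^sup>2) \<le> (2 * s * X\<^sup>2) * B f f"
    using CS unfolding Bx X_def[symmetric] by (simp add: power2_eq_square algebra_simps)
  then have "2 * s * (f a - f b)\<^sup>2 \<le> B f f"
    using s X by (simp add: mult_le_cancel_left_pos)
  then show ?thesis
    using p unfolding s_def B_def p_def[symmetric] by (simp add: field_simps)
qed

end

section \<open>Degrees in the spanning tree, their means and variances\<close>

lemma sum_incident:
  assumes "finite_simple_graph V F"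
  shows "(\<Sum>v\<in>V. \<Sum>e | e \<in> F \<and> v \<in> e. g v e) = (\<Sum>e\<in>F. \<Sum>v\<in>e. g v e)"
proof -
  have "{v. v \<in> V \<and> v \<in> e} = e" if "e \<in> F" for e
    using assms that unfolding finite_simple_graph_def by auto
  moreover have "finite V" using assms unfolding finite_simple_graph_def by simp
  ultimately show ?thesis
    using finite_edges[OF assms] by (subst sum.swap_restrict) auto
qed

lemma vertex_degree_neighbours:
  assumes "finite_simple_graph V F" "v \<in> V"
  shows "(\<Sum>u\<in>V. of_bool ({v, u} \<in> F)) = real (vertex_degree F v)"
proof -
  have fin: "finite V" and edge: "\<And>e. e \<in> F \<Longrightarrow> e \<subseteq> V \<and> card e = 2"
    using assms(1) unfolding finite_simple_graph_def by auto
  have "bij_betw (\<lambda>u. {v, u}) {u \<in> V. {v, u} \<in> F} {e \<in> F. v \<in> e}"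
    unfolding bij_betw_def
  proof
    show "inj_on (\<lambda>u. {v, u}) {u \<in> V. {v, u} \<in> F}"
      by (auto simp: inj_on_def doubleton_eq_iff)
    show "(\<lambda>u. {v, u}) ` {u \<in> V. {v, u} \<in> F} = {e \<in> F. v \<in> e}"
    proof
      show "{e \<in> F. v \<in> e} \<subseteq> (\<lambda>u. {v, u}) ` {u \<in> V. {v, u} \<in> F}"
      proof
        fix e assume e: "e \<in> {e \<in> F. v \<in> e}"
        then obtain u where "e = {v, u}" "u \<in> V"
          using edge_eq[OF assms(1)] by blast
        with e show "e \<in> (\<lambda>u. {v, u}) ` {u \<in> V. {v, u} \<in> F}" by blast
      qed
    qed auto
  qed
  then have "card {u \<in> V. {v, u} \<in> F} = vertex_degree F v"
    unfolding vertex_degree_def by (rule bij_betw_same_card)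
  then show ?thesis
    using fin by (simp add: of_bool_def sum.If_cases Int_def)
qed

lemma exp_le_linear:
  fixes p :: real
  assumes "0 \<le> p" "p \<le> 1"
  shows "exp p \<le> 1 + 2 * p"
  using exp_bound[OF assms] mult_left_le[of p p] assms by (simp add: power2_eq_square)

context connected_simple_graph
begin

abbreviation star :: "'a \<Rightarrow> 'a set set" where "star v \<equiv> {e. e \<in> E \<and> v \<in> e}"

lemma sum_edge_indicator:
  assumes "T \<in> trees" "A \<subseteq> E"
  shows "(\<Sum>e\<in>A. of_bool (e \<in> T)) = real (card (T \<inter> A))"
  using finite_subset[OF assms(2) finite_E]
  by (simp add: of_bool_def sum.If_cases Int_def conj_commute)

lemma vertex_degree_tree:
  assumes "T \<in> trees"
  shows "vertex_degree T v = card (T \<inter> star v)"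
  unfolding vertex_degree_def using treeD(1)[OF assms] by (intro arg_cong[of _ _ card]) auto

lemma sum_vertex_degree_tree:
  assumes "T \<in> trees"
  shows "(\<Sum>v\<in>V. vertex_degree T v) = 2 * (card V - 1)"
proof -
  have "(\<Sum>v\<in>V. vertex_degree T v) = (\<Sum>v\<in>V. \<Sum>e | e \<in> T \<and> v \<in> e. 1)"
    unfolding vertex_degree_def by simp
  also have "\<dots> = (\<Sum>e\<in>T. card e)"
    using sum_incident[OF treeD(3)[OF assms], of "\<lambda>_ _. 1::nat"] by simp
  also have "\<dots> = (\<Sum>e\<in>T. 2)"
    using treeD(1)[OF assms] card_edge by (intro sum.cong) auto
  finally show ?thesis
    using card_tree[OF assms] by simp
qed

lemma vertex_degree_tree_pos:
  assumes "T \<in> trees" "v \<in> V" "2 \<le> card V"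
  shows "1 \<le> vertex_degree T v"
proof -
  have "V \<noteq> {v}" using assms(3) by auto
  then obtain u w where "u \<in> {v}" "w \<in> V - {v}" "{u, w} \<in> T"
    using crossing_edge[OF treeD(3,4)[OF assms(1)], of "{v}"] assms(2) by blast
  then have "{v, w} \<in> {e \<in> T. v \<in> e}" by auto
  then show ?thesis
    unfolding vertex_degree_def using treeD(2)[OF assms(1)]
    by (metis (no_types, lifting) One_nat_def Suc_leI card_gt_0_iff empty_iff finite_subset mem_Collect_eq subsetI)
qed

lemma card_tree_two_stars:
  assumes "T \<in> trees" "v \<in> V" "w \<in> V" "v \<noteq> w"
  shows "card (T \<inter> (star v \<union> star w)) + of_bool ({v, w} \<in> T) = vertex_degree T v + vertex_degree T w"
proof -
  have fin: "finite (T \<inter> star u)" for u using treeD(2)[OF assms(1)] by simp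
  have "(T \<inter> star v) \<inter> (T \<inter> star w) = (if {v, w} \<in> T then {{v, w}} else {})"
  proof -
    have "e = {v, w}" if "e \<in> T" "v \<in> e" "w \<in> e" for e
      using edge_eq[OF treeD(3)[OF assms(1)] that(1,2)] that(3) assms(4) by blast
    then have "{e \<in> T. v \<in> e \<and> w \<in> e} = {e \<in> T. e = {v, w}}" by blast
    moreover have "(T \<inter> star v) \<inter> (T \<inter> star w) = {e \<in> T. v \<in> e \<and> w \<in> e}"
      using treeD(1)[OF assms(1)] by blast
    moreover have "{e \<in> T. e = {v, w}} = (if {v, w} \<in> T then {{v, w}} else {})" by auto
    ultimately show ?thesis by simp
  qed
  then have "card ((T \<inter> star v) \<inter> (T \<inter> star w)) = of_bool ({v, w} \<in> T)" by simp
  moreover have "T \<inter> (star v \<union> star w) = (T \<inter> star v) \<union> (T \<inter> star w)" by blast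
  ultimately show ?thesis
    using card_Un_Int[OF fin fin, of v w] vertex_degree_tree[OF assms(1)] by simp
qed

text \<open>One tree edge leaves \<open>{v, w}\<close>, and its end in this pair is one of the two
  vertices. The other vertex has a tree edge as well, which differs from the first because the first
  does not contain it. This permits dividing the square of \<open>z\<close> out of the generating
  function.\<close>

lemma two_le_card_tree_two_stars:
  assumes T: "T \<in> trees" and vw: "v \<in> V" "w \<in> V" "v \<noteq> w" and V: "3 \<le> card V"
  shows "2 \<le> card (T \<inter> (star v \<union> star w))"
proof -
  have "V \<noteq> {v, w}" using V vw(3) by auto
  then obtain a b where ab: "a \<in> {v, w}" "b \<in> V - {v, w}" "{a, b} \<in> T"
    using crossing_edge[OF treeD(3,4)[OF T], of "{v, w}"] vw by blast
  obtain a' where a': "a' \<in> {v, w}" "a' \<noteq> a" "a' \<in> V"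
    using ab(1) vw by auto
  have "V \<noteq> {a'}" using V by auto
  then obtain b' where b': "{a', b'} \<in> T"
    using crossing_edge[OF treeD(3,4)[OF T], of "{a'}"] a'(3) by blast
  have "{a, b} \<noteq> {a', b'}"
    using ab a' by (auto simp: doubleton_eq_iff)
  then have "2 = card {{a, b}, {a', b'}}" by simp
  also have "\<dots> \<le> card (T \<inter> (star v \<union> star w))"
    using treeD(1,2)[OF T] ab a' b' by (intro card_mono) auto
  finally show ?thesis .
qed

definition mean_degree :: "'a \<Rightarrow> real" where
  "mean_degree v = avg trees (\<lambda>T. real (vertex_degree T v))"

definition var_degree :: "'a \<Rightarrow> real" where
  "var_degree v = avg trees (\<lambda>T. (real (vertex_degree T v))\<^sup>2) - (mean_degree v)\<^sup>2"

lemma avg_const_trees: "avg trees (\<lambda>_. c) = c"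
  by (rule avg_const[OF finite_trees trees_nonempty])

lemma mean_degree_ge_1: "v \<in> V \<Longrightarrow> 2 \<le> card V \<Longrightarrow> 1 \<le> mean_degree v"
  unfolding mean_degree_def using vertex_degree_tree_pos
  by (subst avg_const_trees[of 1, symmetric]) (auto intro!: avg_mono)

lemma mean_degree_eq_sum: "mean_degree v = (\<Sum>e\<in>star v. edge_prob e)"
  unfolding mean_degree_def edge_prob_def avg_sum[symmetric]
  by (intro avg_cong) (simp add: sum_edge_indicator vertex_degree_tree)

lemma sum_mean_degree: "(\<Sum>v\<in>V. mean_degree v) = 2 * (real (card V) - 1)"
proof -
  have "(\<Sum>v\<in>V. mean_degree v) = avg trees (\<lambda>T. 2 * (real (card V) - 1))"
    unfolding mean_degree_def avg_sum[symmetric]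
  proof (intro avg_cong)
    fix T assume "T \<in> trees"
    then have "real (\<Sum>v\<in>V. vertex_degree T v) = real (2 * (card V - 1))"
      using sum_vertex_degree_tree by presburger
    moreover have "1 \<le> card V"
      using finite_V V_nonempty by (simp add: Suc_le_eq card_gt_0_iff)
    ultimately show "(\<Sum>v\<in>V. real (vertex_degree T v)) = 2 * (real (card V) - 1)"
      by (simp add: of_nat_diff)
  qed
  then show ?thesis by (simp add: avg_const_trees)
qed

lemma sum_edge_prob: "(\<Sum>e\<in>E. edge_prob e) = real (card V) - 1"
proof -
  have "(\<Sum>e\<in>E. edge_prob e) = avg trees (\<lambda>T. real (card V) - 1)"
    unfolding edge_prob_def avg_sum[symmetric]
  proof (intro avg_cong)
    fix T assume T: "T \<in> trees"
    have "1 \<le> card V"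
      using finite_V V_nonempty by (simp add: Suc_le_eq card_gt_0_iff)
    then show "(\<Sum>e\<in>E. of_bool (e \<in> T)) = real (card V) - 1"
      using sum_edge_indicator[OF T order_refl] treeD(1)[OF T] card_tree[OF T]
      by (simp add: Int_absorb2 of_nat_diff)
  qed
  then show ?thesis by (simp add: avg_const_trees)
qed

text \<open>
  Summed over \<open>v\<close>, the variance of an edge indicator is counted twice, the covariance of two adjacent edges
  once and that of disjoint edges not at all.  Covariances of distinct edges are nonpositive, and all
  covariances together add up to the variance \<open>0\<close> of \<open>card T\<close>.
\<close>

lemma sum_var_degree_ge: "(\<Sum>e\<in>E. edge_prob e - (edge_prob e)\<^sup>2) \<le> (\<Sum>v\<in>V. var_degree v)"
proof -
  define P where "P e f = avg trees (\<lambda>T. of_bool (e \<in> T) * of_bool (f \<in> T))" for e f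
  define cov where "cov e f = P e f - edge_prob e * edge_prob f" for e f
  have cov_self: "cov e e = edge_prob e - (edge_prob e)\<^sup>2" for e
  proof -
    have "P e e = edge_prob e"
      unfolding P_def edge_prob_def by (intro avg_cong) auto
    then show ?thesis unfolding cov_def by (simp add: power2_eq_square)
  qed
  have cov_neg: "cov e f \<le> 0" if "e \<in> E" "f \<in> E" "e \<noteq> f" for e f
    using negative_correlation[OF that] unfolding cov_def P_def by simp
  have cov_sum: "(\<Sum>f\<in>E. cov e f) = 0" for e
  proof -
    have "(\<Sum>f\<in>E. P e f) = avg trees (\<lambda>T. of_bool (e \<in> T) * (\<Sum>f\<in>E. of_bool (f \<in> T)))"
      unfolding P_def avg_sum[symmetric] sum_distrib_left ..
    also have "\<dots> = avg trees (\<lambda>T. (real (card V) - 1) * of_bool (e \<in> T))"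
    proof (intro avg_cong)
      fix T assume T: "T \<in> trees"
      have "1 \<le> card V"
        using finite_V V_nonempty by (simp add: Suc_le_eq card_gt_0_iff)
      then show "of_bool (e \<in> T) * (\<Sum>f\<in>E. of_bool (f \<in> T)) = (real (card V) - 1) * of_bool (e \<in> T)"
        using sum_edge_indicator[OF T order_refl] treeD(1)[OF T] card_tree[OF T]
        by (simp add: Int_absorb2 of_nat_diff)
    qed
    also have "\<dots> = edge_prob e * (\<Sum>f\<in>E. edge_prob f)"
      unfolding avg_cmult sum_edge_prob by (simp add: edge_prob_def mult.commute)
    finally show ?thesis
      unfolding cov_def sum_subtractf sum_distrib_left by simp
  qed
  have var: "var_degree v = (\<Sum>e\<in>star v. \<Sum>f\<in>star v. cov e f)" for v
  proof -
    have "avg trees (\<lambda>T. (real (vertex_degree T v))\<^sup>2) =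
        avg trees (\<lambda>T. \<Sum>e\<in>star v. \<Sum>f\<in>star v. of_bool (e \<in> T) * of_bool (f \<in> T))"
    proof (intro avg_cong)
      fix T assume T: "T \<in> trees"
      have "real (vertex_degree T v) = (\<Sum>e\<in>star v. of_bool (e \<in> T))"
        using sum_edge_indicator[OF T, of "star v"] vertex_degree_tree[OF T] by auto
      then show "(real (vertex_degree T v))\<^sup>2 = (\<Sum>e\<in>star v. \<Sum>f\<in>star v. of_bool (e \<in> T) * of_bool (f \<in> T))"
        by (simp only: power2_eq_square sum_product)
    qed
    also have "\<dots> = (\<Sum>e\<in>star v. \<Sum>f\<in>star v. P e f)"
      unfolding P_def avg_sum ..
    finally show ?thesis
      unfolding var_degree_def mean_degree_eq_sum cov_def power2_eq_square sum_product sum_subtractf by simp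
  qed
  have "(\<Sum>v\<in>V. var_degree v) = (\<Sum>e\<in>E. \<Sum>v\<in>e. \<Sum>f\<in>star v. cov e f)"
    unfolding var by (rule sum_incident[OF simple])
  \<comment> \<open>A pair \<open>(e, f)\<close> is counted once for each common vertex.\<close>
  also have "\<dots> = (\<Sum>e\<in>E. \<Sum>f\<in>E. real (card (e \<inter> f)) * cov e f)"
  proof (rule sum.cong[OF refl])
    fix e assume e: "e \<in> E"
    have "finite e" using edge_subset[OF e] finite_V by (rule finite_subset)
    then have "(\<Sum>v\<in>e. \<Sum>f\<in>star v. cov e f) = (\<Sum>f\<in>E. \<Sum>v | v \<in> e \<and> v \<in> f. cov e f)"
      using finite_E by (rule sum.swap_restrict)
    then show "(\<Sum>v\<in>e. \<Sum>f\<in>star v. cov e f) = (\<Sum>f\<in>E. real (card (e \<inter> f)) * cov e f)"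
      by (simp add: Int_def)
  qed
  finally have total: "(\<Sum>v\<in>V. var_degree v) = (\<Sum>e\<in>E. \<Sum>f\<in>E. real (card (e \<inter> f)) * cov e f)" .
  have "cov e e \<le> (\<Sum>f\<in>E. real (card (e \<inter> f)) * cov e f)" if e: "e \<in> E" for e
  proof -
    \<comment> \<open>The sum of \<open>cov e f\<close> over \<open>f\<close> is 0 and may be added.
      It then suffices to compare terms: the coefficient \<open>card (e \<inter> f) - 1\<close> is 1
      for \<open>f = e\<close> and at most 0 otherwise, where \<open>cov e f\<close> is
      nonpositive.\<close>
    have "cov e e = (\<Sum>f\<in>E. cov e f + (if f = e then cov e e else 0))"
      using e finite_E cov_sum[of e] by (simp add: sum.distrib)
    also have "\<dots> \<le> (\<Sum>f\<in>E. real (card (e \<inter> f)) * cov e f)"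
    proof (rule sum_mono)
      fix f assume f: "f \<in> E"
      show "cov e f + (if f = e then cov e e else 0) \<le> real (card (e \<inter> f)) * cov e f"
      proof (cases "f = e")
        case True
        then show ?thesis using card_edge[OF e] by simp
      next
        case False
        have fin: "finite e" "finite f"
          using edge_subset e f finite_V by (auto intro: finite_subset)
        have "\<not> e \<subseteq> f"
          using False card_subset_eq[OF fin(2), of e] card_edge e f by auto
        then have "card (e \<inter> f) < card e"
          using fin by (intro psubset_card_mono) auto
        then have "real (card (e \<inter> f)) \<le> 1" using card_edge[OF e] by simp
        then show ?thesis
          using False cov_neg[OF e f] mult_right_mono_neg[of "real (card (e \<inter> f))" 1 "cov e f"] by simp
      qed
    qed
    finally show ?thesis .
  qed
  then show ?thesis
    unfolding total cov_self[symmetric] by (rule sum_mono)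
qed

text \<open>Mean minus variance of the degree less one, that is, the sum of the squared Bernoulli
  parameters; it measures the distance from a Poisson law.\<close>

definition excess :: "'a \<Rightarrow> real" where
  "excess v = mean_degree v - 1 - var_degree v"

text \<open>The linear terms nearly cancel: the numbers \<open>mean_degree v - 1\<close> sum to
  \<open>card V - 2\<close>, the edge probabilities to \<open>card V - 1\<close>.\<close>

lemma sum_excess_le: "(\<Sum>v\<in>V. excess v) \<le> (\<Sum>e\<in>E. (edge_prob e)\<^sup>2)"
proof -
  have "(\<Sum>v\<in>V. excess v) = 2 * (real (card V) - 1) - real (card V) - (\<Sum>v\<in>V. var_degree v)"
    unfolding excess_def by (simp add: sum_subtractf sum_mean_degree)
  also have "\<dots> \<le> real (card V) - 2 - (\<Sum>e\<in>E. edge_prob e - (edge_prob e)\<^sup>2)"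
    using sum_var_degree_ge by simp
  also have "\<dots> \<le> (\<Sum>e\<in>E. (edge_prob e)\<^sup>2)"
    by (simp add: sum_subtractf sum_edge_prob)
  finally show ?thesis .
qed

text \<open>\<open>stable_pgf_bounds\<close> is applied to the degree less one, since all degrees
  are at least 1; its mean is \<open>mean_degree v - 1\<close> and its mean minus variance is
  \<open>excess v\<close>.\<close>

lemma pgf_degree_lower:
  assumes v: "v \<in> V" and V: "2 \<le> card V" and x: "0 \<le> x" "x \<le> 1"
  shows "x * (exp (- (1 - x) * (mean_degree v - 1)) - excess v / 2) \<le> avg trees (\<lambda>T. x ^ vertex_degree T v)"
    and "0 \<le> excess v"
proof -
  define X where "X T = card (T \<inter> star v) - 1" for T
  have deg: "vertex_degree T v = Suc (X T)" if "T \<in> trees" for T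
    using vertex_degree_tree_pos[OF that v V] vertex_degree_tree[OF that, of v] unfolding X_def by simp
  have stable: "(\<Sum>T\<in>trees. z ^ X T) \<noteq> 0" if "Im z \<noteq> 0 \<or> Re z > 0" for z
    unfolding X_def using vertex_degree_tree_pos[OF _ v V] vertex_degree_tree that
    by (intro stable_edge_count) auto
  have m: "avg trees (\<lambda>T. real (X T)) = mean_degree v - 1"
  proof -
    have "avg trees (\<lambda>T. real (X T)) = avg trees (\<lambda>T. real (vertex_degree T v) - 1)"
      using deg by (intro avg_cong) simp
    then show ?thesis
      unfolding mean_degree_def by (simp add: avg_diff avg_const_trees)
  qed
  have "avg trees (\<lambda>T. (real (X T))\<^sup>2) =
      avg trees (\<lambda>T. (real (vertex_degree T v))\<^sup>2 - 2 * real (vertex_degree T v) + 1)"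
    using deg by (intro avg_cong) (simp add: power2_eq_square algebra_simps)
  also have "\<dots> = var_degree v + (mean_degree v)\<^sup>2 - 2 * mean_degree v + 1"
    unfolding avg_add avg_diff avg_cmult avg_const_trees var_degree_def mean_degree_def by simp
  finally have q: "mean_degree v - 1 - avg trees (\<lambda>T. (real (X T))\<^sup>2) + (mean_degree v - 1)\<^sup>2 = excess v"
    unfolding excess_def by (simp add: power2_eq_square algebra_simps)
  note bounds = stable_pgf_bounds[OF finite_trees trees_nonempty stable x, unfolded m q]
  show "0 \<le> excess v" by (rule bounds(3))
  have "avg trees (\<lambda>T. x ^ vertex_degree T v) = avg trees (\<lambda>T. x * x ^ X T)"
    using deg by (intro avg_cong) simp
  also have "\<dots> = x * avg trees (\<lambda>T. x ^ X T)" by (rule avg_cmult)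
  also have "\<dots> \<ge> x * (exp (- (1 - x) * (mean_degree v - 1)) - excess v / 2)"
    using bounds(2) x(1) by (rule mult_left_mono)
  finally show "x * (exp (- (1 - x) * (mean_degree v - 1)) - excess v / 2) \<le> avg trees (\<lambda>T. x ^ vertex_degree T v)" .
qed

section \<open>Second moment of the degree generating function\<close>

text \<open>Generating function at \<open>x\<close> of 1 plus a Poisson variable of mean
  \<open>mean_degree v - 1\<close>.\<close>

definition pgf_limit :: "real \<Rightarrow> 'a \<Rightarrow> real" where
  "pgf_limit x v = x * exp (- (1 - x) * (mean_degree v - 1))"

lemma pgf_limit_bounds:
  assumes "v \<in> V" "2 \<le> card V" "0 \<le> x" "x \<le> 1"
  shows "0 \<le> pgf_limit x v" "pgf_limit x v \<le> 1"
proof -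
  have "exp (- (1 - x) * (mean_degree v - 1)) \<le> 1"
    using mean_degree_ge_1[OF assms(1,2)] assms(4) by (simp add: mult_nonpos_nonneg)
  then show "0 \<le> pgf_limit x v" "pgf_limit x v \<le> 1"
    using assms(3,4) unfolding pgf_limit_def by (auto intro: mult_le_one)
qed

text \<open>The number of tree edges meeting \<open>{v, w}\<close> is the sum of the two degrees,
  less 1 if \<open>{v, w}\<close> is in the tree. Using it as exponent only increases the power of
  \<open>x\<close>, and its mean is smaller than that of the degree sum by \<open>p\<close>, which
  costs the factor \<open>exp ((1 - x) * p)\<close>.\<close>

lemma pgf_two_degrees_upper:
  assumes vw: "v \<in> V" "w \<in> V" "v \<noteq> w" and V: "3 \<le> card V" and x: "0 \<le> x" "x \<le> 1"
  shows "avg trees (\<lambda>T. x ^ vertex_degree T v * x ^ vertex_degree T w) \<le> pgf_limit x v * pgf_limit x w + 2 * edge_prob {v, w}"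
proof -
  define X where "X T = card (T \<inter> (star v \<union> star w)) - 2" for T
  define p where "p = edge_prob {v, w}"
  have p: "0 \<le> p" "p \<le> 1" unfolding p_def by (rule edge_prob_bounds)+
  have X: "X T + 2 + of_bool ({v, w} \<in> T) = vertex_degree T v + vertex_degree T w" if "T \<in> trees" for T
    using two_le_card_tree_two_stars[OF that vw V] card_tree_two_stars[OF that vw] unfolding X_def by linarith
  have stable: "(\<Sum>T\<in>trees. z ^ X T) \<noteq> 0" if "Im z \<noteq> 0 \<or> Re z > 0" for z
    unfolding X_def using two_le_card_tree_two_stars[OF _ vw V] that by (rule stable_edge_count)
  have m: "avg trees (\<lambda>T. real (X T)) = mean_degree v + mean_degree w - p - 2"
  proof -
    have "avg trees (\<lambda>T. real (X T)) = avg trees (\<lambda>T. real (vertex_degree T v) + real (vertex_degree T w) - of_bool ({v, w} \<in> T) - 2)"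
    proof (rule avg_cong)
      fix T assume "T \<in> trees"
      then have "real (X T + 2 + of_bool ({v, w} \<in> T)) = real (vertex_degree T v + vertex_degree T w)"
        using X by presburger
      then show "real (X T) = real (vertex_degree T v) + real (vertex_degree T w) - of_bool ({v, w} \<in> T) - 2"
        by simp
    qed
    then show ?thesis
      unfolding avg_add avg_diff avg_const_trees mean_degree_def p_def edge_prob_def by simp
  qed
  have "avg trees (\<lambda>T. x ^ vertex_degree T v * x ^ vertex_degree T w) \<le> avg trees (\<lambda>T. x\<^sup>2 * x ^ X T)"
  proof (rule avg_mono)
    fix T assume T: "T \<in> trees"
    have "x ^ (vertex_degree T v + vertex_degree T w) \<le> x ^ (2 + X T)"
      using X[OF T] x by (intro power_decreasing) auto
    then show "x ^ vertex_degree T v * x ^ vertex_degree T w \<le> x\<^sup>2 * x ^ X T"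
      by (simp only: power_add)
  qed
  also have "\<dots> = x\<^sup>2 * avg trees (\<lambda>T. x ^ X T)" by (rule avg_cmult)
  also have "\<dots> \<le> x\<^sup>2 * exp (- (1 - x) * (mean_degree v + mean_degree w - p - 2))"
    using stable_pgf_bounds(1)[OF finite_trees trees_nonempty stable x, unfolded m]
    by (intro mult_left_mono) auto
  also have "\<dots> = pgf_limit x v * pgf_limit x w * exp ((1 - x) * p)"
    unfolding pgf_limit_def by (simp add: power2_eq_square exp_add[symmetric] algebra_simps)
  also have "\<dots> \<le> pgf_limit x v * pgf_limit x w * (1 + 2 * p)"
  proof (rule mult_left_mono)
    have "exp ((1 - x) * p) \<le> exp p" using p x by (simp add: mult_left_le_one_le)
    then show "exp ((1 - x) * p) \<le> 1 + 2 * p" using exp_le_linear[OF p] by (rule order_trans)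
    show "0 \<le> pgf_limit x v * pgf_limit x w"
      using vw V x by (intro mult_nonneg_nonneg pgf_limit_bounds(1)) auto
  qed
  also have "\<dots> \<le> pgf_limit x v * pgf_limit x w + 2 * p"
  proof -
    have "pgf_limit x v * pgf_limit x w \<le> 1"
      using vw V x by (intro mult_le_one pgf_limit_bounds) auto
    then have "pgf_limit x v * pgf_limit x w * p \<le> p" 
      using mult_right_mono[of "pgf_limit x v * pgf_limit x w" 1 p] p by simp
    then show ?thesis by (simp add: algebra_simps)
  qed
  finally show ?thesis unfolding p_def .
qed

text \<open>Expand the square around \<open>A\<close>: the pair bounds control the second moment
  from above, the single-vertex bounds control the mean from below.\<close>

lemma pgf_second_moment:
  assumes V: "3 \<le> card V" and x: "0 \<le> x" "x \<le> 1"
  shows "avg trees (\<lambda>T. ((\<Sum>v\<in>V. x ^ vertex_degree T v) - (\<Sum>v\<in>V. pgf_limit x v))\<^sup>2)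
    \<le> real (card V) * (5 + (\<Sum>v\<in>V. excess v))"
proof -
  define n where "n = real (card V)"
  define S where "S T = (\<Sum>v\<in>V. x ^ vertex_degree T v)" for T
  define A where "A = (\<Sum>v\<in>V. pgf_limit x v)"
  define Q where "Q = (\<Sum>v\<in>V. excess v)"
  have V2: "2 \<le> card V" using V by simp
  have A: "0 \<le> A" "A \<le> n"
    unfolding A_def n_def using pgf_limit_bounds[OF _ V2 x]
    by (auto intro!: sum_nonneg sum_bounded_above[where K = 1, simplified])
  have Q: "0 \<le> Q" unfolding Q_def using pgf_degree_lower(2)[OF _ V2 x] by (intro sum_nonneg)
  have "A - Q / 2 \<le> (\<Sum>v\<in>V. avg trees (\<lambda>T. x ^ vertex_degree T v))"
    unfolding A_def Q_def sum_divide_distrib sum_subtractf[symmetric]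
  proof (rule sum_mono)
    fix v assume v: "v \<in> V"
    have "x * (excess v / 2) \<le> excess v / 2"
      using x pgf_degree_lower(2)[OF v V2 x] by (intro mult_left_le_one_le) auto
    then show "pgf_limit x v - excess v / 2 \<le> avg trees (\<lambda>T. x ^ vertex_degree T v)"
      using pgf_degree_lower(1)[OF v V2 x] unfolding pgf_limit_def by (simp add: right_diff_distrib)
  qed
  then have ES: "A - Q / 2 \<le> avg trees S"
    unfolding S_def avg_sum .
  have "avg trees (\<lambda>T. (S T)\<^sup>2) = (\<Sum>v\<in>V. \<Sum>w\<in>V. avg trees (\<lambda>T. x ^ vertex_degree T v * x ^ vertex_degree T w))"
    unfolding S_def power2_eq_square sum_product avg_sum ..
  also have "\<dots> \<le> (\<Sum>v\<in>V. \<Sum>w\<in>V. pgf_limit x v * pgf_limit x w + 2 * edge_prob {v, w} + (if v = w then 1 else 0))"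
  proof (intro sum_mono)
    fix v w assume vw: "v \<in> V" "w \<in> V"
    show "avg trees (\<lambda>T. x ^ vertex_degree T v * x ^ vertex_degree T w)
      \<le> pgf_limit x v * pgf_limit x w + 2 * edge_prob {v, w} + (if v = w then 1 else 0)"
    proof (cases "v = w")
      case True
      have "avg trees (\<lambda>T. x ^ vertex_degree T v * x ^ vertex_degree T w) \<le> avg trees (\<lambda>T. 1)"
        using x by (intro avg_mono mult_le_one power_le_one) auto
      moreover have "0 \<le> pgf_limit x v * pgf_limit x w"
        using pgf_limit_bounds(1)[OF _ V2 x] vw by simp
      ultimately show ?thesis
        unfolding if_P[OF True] using edge_prob_bounds(1)[of "{v, w}"] avg_const_trees[of 1] by linarith
    qed (use pgf_two_degrees_upper[OF vw _ V x] in simp)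
  qed
  also have "\<dots> = A\<^sup>2 + 2 * (\<Sum>v\<in>V. \<Sum>w\<in>V. edge_prob {v, w}) + n"
    using finite_V unfolding A_def n_def power2_eq_square sum_product by (simp add: sum.distrib sum_distrib_left)
  also have "(\<Sum>v\<in>V. \<Sum>w\<in>V. edge_prob {v, w}) = 2 * (n - 1)"
  proof -
    have "(\<Sum>w\<in>V. edge_prob {v, w}) = mean_degree v" if "v \<in> V" for v
      unfolding edge_prob_def mean_degree_def avg_sum[symmetric]
      using vertex_degree_neighbours[OF treeD(3) that] by (intro avg_cong) auto
    then show ?thesis using sum_mean_degree unfolding n_def by simp
  qed
  \<comment> \<open>The diagonal gives \<open>n\<close> and the edge probabilities
    \<open>4 * (n - 1)\<close>.\<close>
  finally have ES2: "avg trees (\<lambda>T. (S T)\<^sup>2) \<le> A\<^sup>2 + 5 * n" by simp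
  have "avg trees (\<lambda>T. (S T - A)\<^sup>2) = avg trees (\<lambda>T. (S T)\<^sup>2 - (2 * A) * S T + A\<^sup>2)"
    by (intro avg_cong) (simp add: power2_diff)
  also have "\<dots> = avg trees (\<lambda>T. (S T)\<^sup>2) - 2 * A * avg trees S + A\<^sup>2"
    unfolding avg_add avg_diff avg_cmult avg_const_trees ..
  also have "\<dots> \<le> A\<^sup>2 + 5 * n - 2 * A * (A - Q / 2) + A\<^sup>2"
    using ES2 mult_left_mono[OF ES, of "2 * A"] A by simp
  also have "\<dots> = 5 * n + A * Q" by (simp add: power2_eq_square algebra_simps)
  also have "\<dots> \<le> 5 * n + n * Q" using A Q by (simp add: mult_right_mono)
  also have "\<dots> = n * (5 + Q)" by (simp add: algebra_simps)
  finally show ?thesis unfolding S_def A_def Q_def n_def .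
qed

section \<open>Edge probabilities in a dense graph\<close>

text \<open>Dirichlet's principle with a test function supported on the two ends, equal to the
  reciprocal degree at one and to minus the reciprocal degree at the other.\<close>

lemma edge_prob_lower:
  assumes e: "e \<in> E"
  shows "(\<Sum>v\<in>e. 1 / real (vertex_degree E v)) - (\<Sum>v\<in>e. (1 / real (vertex_degree E v))\<^sup>2) \<le> edge_prob e"
proof -
  from card_edge[OF e] obtain a b where ab: "e = {a, b}" "a \<noteq> b"
    by (auto simp: card_2_iff)
  define d where "d v = real (vertex_degree E v)" for v
  have abV: "a \<in> V" "b \<in> V" using edge_subset[OF e] ab by auto
  have d: "d v \<ge> 1" if "v \<in> e" for v
  proof -
    have "e \<in> {e \<in> E. v \<in> e}" using e that by simp
    then have "0 < vertex_degree E v"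
      unfolding vertex_degree_def using finite_E by (auto simp: card_gt_0_iff)
    then show ?thesis unfolding d_def by simp
  qed
  define \<alpha> where "\<alpha> = 1 / d a"
  define \<beta> where "\<beta> = 1 / d b"
  have pos: "\<alpha> > 0" "\<beta> > 0" and da: "d a * \<alpha> = 1" and db: "d b * \<beta> = 1"
    using d[of a] d[of b] ab unfolding \<alpha>_def \<beta>_def by auto
  define f where "f v = (if v = a then \<alpha> else if v = b then - \<beta> else 0)" for v
  have lap: "(\<Sum>u\<in>V. of_bool ({v, u} \<in> E) * (f v - f u)) = d v * f v - (\<Sum>u\<in>V. of_bool ({v, u} \<in> E) * f u)"
    if "v \<in> V" for v
    using vertex_degree_neighbours[OF simple that]
    by (simp add: right_diff_distrib sum_subtractf sum_distrib_right[symmetric] d_def)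
  have fsum: "(\<Sum>u\<in>V. of_bool ({v, u} \<in> E) * f u) = of_bool ({v, a} \<in> E) * \<alpha> - of_bool ({v, b} \<in> E) * \<beta>" for v
  proof -
    have "(\<Sum>u\<in>V. of_bool ({v, u} \<in> E) * f u) =
        (\<Sum>u\<in>V. (if u = a then of_bool ({v, a} \<in> E) * \<alpha> else 0) - (if u = b then of_bool ({v, b} \<in> E) * \<beta> else 0))"
      using ab(2) by (intro sum.cong) (auto simp: f_def)
    also have "\<dots> = of_bool ({v, a} \<in> E) * \<alpha> - of_bool ({v, b} \<in> E) * \<beta>"
      unfolding sum_subtractf using abV finite_V by simp
    finally show ?thesis .
  qed
  have lap_a: "(\<Sum>u\<in>V. of_bool ({a, u} \<in> E) * (f a - f u)) = 1 + \<beta>"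
    unfolding lap[OF abV(1)] fsum using e da by (simp add: ab(1) f_def singleton_notin)
  have lap_b: "(\<Sum>u\<in>V. of_bool ({b, u} \<in> E) * (f b - f u)) = - 1 - \<alpha>"
    unfolding lap[OF abV(2)] fsum using e db ab(2) by (simp add: ab(1) f_def singleton_notin insert_commute)
  have "(\<Sum>v\<in>V. \<Sum>u\<in>V. of_bool ({v, u} \<in> E) * ((f v - f u) * (f v - f u)))
      = 2 * (\<Sum>v\<in>V. f v * (\<Sum>u\<in>V. of_bool ({v, u} \<in> E) * (f v - f u)))"
    by (rule sum_dirichlet[symmetric]) (simp add: insert_commute)
  also have "(\<Sum>v\<in>V. f v * (\<Sum>u\<in>V. of_bool ({v, u} \<in> E) * (f v - f u))) =
      (\<Sum>v\<in>{a, b}. f v * (\<Sum>u\<in>V. of_bool ({v, u} \<in> E) * (f v - f u)))"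
    using abV finite_V by (intro sum.mono_neutral_right) (auto simp: f_def)
  also have "\<dots> = f a * (1 + \<beta>) + f b * (- 1 - \<alpha>)"
    using ab(2) by (simp add: lap_a lap_b)
  also have "\<dots> = \<alpha> * (1 + \<beta>) + \<beta> * (1 + \<alpha>)"
    using ab(2) by (simp add: f_def algebra_simps)
  finally have "2 * (\<alpha> + \<beta>)\<^sup>2 \<le> edge_prob e * (2 * (\<alpha> * (1 + \<beta>) + \<beta> * (1 + \<alpha>)))"
    using edge_prob_energy[of a b f] e ab by (simp add: f_def)
  then have main: "(\<alpha> + \<beta>)\<^sup>2 \<le> edge_prob e * (\<alpha> + \<beta> + 2 * \<alpha> * \<beta>)"
    by (simp add: algebra_simps)
  \<comment> \<open>Replaces division by \<open>\<alpha> + \<beta> + 2 * \<alpha> * \<beta>\<close>: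
    the common factor is cancelled afterwards.\<close>
  have "(\<alpha> + \<beta> - 2 * \<alpha> * \<beta>) * (\<alpha> + \<beta> + 2 * \<alpha> * \<beta>) \<le> edge_prob e * (\<alpha> + \<beta> + 2 * \<alpha> * \<beta>)"
  proof -
    have "(\<alpha> + \<beta> - 2 * \<alpha> * \<beta>) * (\<alpha> + \<beta> + 2 * \<alpha> * \<beta>) = (\<alpha> + \<beta>)\<^sup>2 - (2 * \<alpha> * \<beta>)\<^sup>2"
      by (simp add: power2_eq_square algebra_simps)
    then show ?thesis using main zero_le_power2[of "2 * \<alpha> * \<beta>"] by linarith
  qed
  then have "\<alpha> + \<beta> - 2 * \<alpha> * \<beta> \<le> edge_prob e"
    using pos by (simp add: mult_le_cancel_right add_pos_pos not_less add_nonneg_nonneg)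
  moreover have "2 * \<alpha> * \<beta> \<le> \<alpha>\<^sup>2 + \<beta>\<^sup>2"
    by (rule sum_squares_bound)
  ultimately show ?thesis
    using ab unfolding \<alpha>_def \<beta>_def d_def by simp
qed

lemma vertex_degree_pos:
  assumes "v \<in> V" "2 \<le> card V"
  shows "1 \<le> vertex_degree E v"
proof -
  obtain T where T: "T \<in> trees" using trees_nonempty by blast
  have "vertex_degree T v \<le> vertex_degree E v"
    unfolding vertex_degree_def using treeD(1)[OF T] finite_E by (intro card_mono) auto
  then show ?thesis using vertex_degree_tree_pos[OF T assms] by simp
qed

text \<open>Let \<open>y e \<ge> 0\<close> be the slack in \<open>edge_prob_lower\<close>, so that
  \<open>edge_prob e \<le> s e + y e\<close>. Since the \<open>s e\<close> sum to
  \<open>card V\<close> and the probabilities to \<open>card V - 1\<close>, the total slack is less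
  than the sum of the \<open>t e\<close>, which is the sum of the reciprocal degrees.\<close>

lemma sum_edge_prob_squared_le:
  assumes V: "2 \<le> card V"
  shows "(\<Sum>e\<in>E. (edge_prob e)\<^sup>2) \<le>
    (\<Sum>v\<in>V. 1 / real (vertex_degree E v)) + (\<Sum>v\<in>V. mean_degree v / real (vertex_degree E v))"
proof -
  define d where "d v = real (vertex_degree E v)" for v
  define s where "s e = (\<Sum>v\<in>e. 1 / d v)" for e
  define t where "t e = (\<Sum>v\<in>e. (1 / d v)\<^sup>2)" for e
  define y where "y e = edge_prob e - s e + t e" for e
  have d: "1 \<le> d v" if "v \<in> V" for v
    using vertex_degree_pos[OF that V] unfolding d_def by simp
  have star: "(\<Sum>v\<in>V. \<Sum>e\<in>star v. c v) = (\<Sum>v\<in>V. d v * c v)" for c :: "'a \<Rightarrow> real"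
    unfolding d_def vertex_degree_def by simp
  have sum_s: "(\<Sum>e\<in>E. s e) = real (card V)"
  proof -
    have "(\<Sum>e\<in>E. s e) = (\<Sum>v\<in>V. d v * (1 / d v))"
      unfolding s_def sum_incident[OF simple, symmetric] by (rule star)
    also have "\<dots> = (\<Sum>v\<in>V. 1)"
    proof (rule sum.cong[OF refl])
      fix v assume "v \<in> V"
      from d[OF this] show "d v * (1 / d v) = 1" by simp
    qed
    finally show ?thesis by simp
  qed
  have sum_t: "(\<Sum>e\<in>E. t e) = (\<Sum>v\<in>V. 1 / d v)"
  proof -
    have "(\<Sum>e\<in>E. t e) = (\<Sum>v\<in>V. d v * (1 / d v)\<^sup>2)"
      unfolding t_def sum_incident[OF simple, symmetric] by (rule star)
    also have "\<dots> = (\<Sum>v\<in>V. 1 / d v)"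
      by (rule sum.cong[OF refl]) (simp add: power2_eq_square)
    finally show ?thesis .
  qed
  have y: "0 \<le> y e" if "e \<in> E" for e
    using edge_prob_lower[OF that] unfolding y_def s_def t_def d_def by simp
  have t: "0 \<le> t e" for e
    unfolding t_def by (intro sum_nonneg) simp
  have "(\<Sum>e\<in>E. (edge_prob e)\<^sup>2) \<le> (\<Sum>e\<in>E. edge_prob e * s e + y e)"
  proof (rule sum_mono)
    fix e assume e: "e \<in> E"
    have "edge_prob e * edge_prob e \<le> edge_prob e * (s e + y e)"
      using edge_prob_bounds[of e] t[of e] unfolding y_def by (intro mult_left_mono) auto
    moreover have "edge_prob e * y e \<le> y e"
      using edge_prob_bounds[of e] y[OF e] by (intro mult_left_le_one_le)
    ultimately show "(edge_prob e)\<^sup>2 \<le> edge_prob e * s e + y e"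
      by (simp add: power2_eq_square distrib_left)
  qed
  also have "\<dots> = (\<Sum>e\<in>E. edge_prob e * s e) + (\<Sum>v\<in>V. 1 / d v) - 1"
    unfolding sum.distrib y_def sum_subtractf sum_s sum_t sum_edge_prob by simp
  also have "(\<Sum>e\<in>E. edge_prob e * s e) = (\<Sum>v\<in>V. mean_degree v / d v)"
  proof -
    have "(\<Sum>e\<in>E. edge_prob e * s e) = (\<Sum>v\<in>V. \<Sum>e\<in>star v. edge_prob e / d v)"
      unfolding s_def sum_distrib_left sum_incident[OF simple] by simp
    then show ?thesis
      unfolding mean_degree_eq_sum sum_divide_distrib by simp
  qed
  finally show ?thesis unfolding d_def by simp
qed

lemma sum_excess_le_of_degrees:
  assumes V: "2 \<le> card V" and \<delta>: "\<delta> > 0"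
    and good: "(1 - \<gamma>) * real (card V) \<le> real (card {v \<in> V. \<delta> * real (card V) \<le> real (vertex_degree E v)})"
  shows "(\<Sum>v\<in>V. excess v) \<le> 3 / \<delta> + 2 * \<gamma> * real (card V)"
proof -
  define n where "n = real (card V)"
  define d where "d v = real (vertex_degree E v)" for v
  define G where "G = {v \<in> V. \<delta> * n \<le> d v}"
  have n: "n > 0" using V unfolding n_def by simp
  have d: "1 \<le> d v" if "v \<in> V" for v
    using vertex_degree_pos[OF that V] unfolding d_def by simp
  have fin: "finite G" "finite (V - G)" and sub: "G \<subseteq> V"
    using finite_V unfolding G_def by auto
  have bad: "real (card (V - G)) \<le> \<gamma> * n"
  proof -
    have "real (card (V - G)) = n - real (card G)"
      using card_Diff_subset[OF fin(1) sub] card_mono[OF finite_V sub] unfolding n_def by (simp add: of_nat_diff)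
    then show ?thesis
      using good unfolding n_def[symmetric] d_def[symmetric] G_def[symmetric] by (simp add: algebra_simps)
  qed
  \<comment> \<open>Vertices in \<open>G\<close> have \<open>d v \<ge> \<delta> * n\<close>; each of
    the at most \<open>\<gamma> * n\<close> others contributes at most 1. Used below for
    \<open>h = 1\<close> and for the mean degrees, with totals \<open>n\<close> and
    \<open>2 * (n - 1)\<close>.\<close>
  have split: "(\<Sum>v\<in>V. h v / d v) \<le> (\<Sum>v\<in>V. h v) / (\<delta> * n) + \<gamma> * n"
    if h: "\<And>v. v \<in> V \<Longrightarrow> 0 \<le> h v" "\<And>v. v \<in> V \<Longrightarrow> h v \<le> d v" for h
  proof -
    have "(\<Sum>v\<in>V. h v / d v) = (\<Sum>v\<in>V - G. h v / d v) + (\<Sum>v\<in>G. h v / d v)"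
      by (rule sum.subset_diff[OF sub finite_V])
    also have "(\<Sum>v\<in>V - G. h v / d v) \<le> real (card (V - G)) * 1"
      using h d by (intro sum_bounded_above) (force simp: divide_le_eq_1)
    also have "(\<Sum>v\<in>G. h v / d v) \<le> (\<Sum>v\<in>G. h v / (\<delta> * n))"
      using h(1) n \<delta> by (intro sum_mono divide_left_mono) (auto simp: G_def intro!: mult_pos_pos dest!: d)
    also have "\<dots> \<le> (\<Sum>v\<in>V. h v / (\<delta> * n))"
      using h(1) n \<delta> sub finite_V by (intro sum_mono2) auto
    finally show ?thesis using bad by (simp add: sum_divide_distrib)
  qed
  have "(\<Sum>v\<in>V. 1 / d v) \<le> n / (\<delta> * n) + \<gamma> * n"
    using split[of "\<lambda>_. 1"] d unfolding n_def by simp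
  moreover have "(\<Sum>v\<in>V. mean_degree v / d v) \<le> (2 * n) / (\<delta> * n) + \<gamma> * n"
  proof -
    have "(\<Sum>v\<in>V. mean_degree v / d v) \<le> (\<Sum>v\<in>V. mean_degree v) / (\<delta> * n) + \<gamma> * n"
    proof (rule split)
      fix v assume v: "v \<in> V"
      show "0 \<le> mean_degree v" using mean_degree_ge_1[OF v V] by simp
      have "mean_degree v \<le> (\<Sum>e\<in>star v. 1)"
        unfolding mean_degree_eq_sum by (intro sum_mono edge_prob_bounds)
      then show "mean_degree v \<le> d v" unfolding d_def vertex_degree_def by simp
    qed
    also have "(\<Sum>v\<in>V. mean_degree v) / (\<delta> * n) \<le> (2 * n) / (\<delta> * n)"
      unfolding sum_mean_degree using n \<delta> by (intro divide_right_mono) (auto simp: n_def)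
    finally show ?thesis by simp
  qed
  ultimately have "(\<Sum>e\<in>E. (edge_prob e)\<^sup>2) \<le> n / (\<delta> * n) + (2 * n) / (\<delta> * n) + 2 * \<gamma> * n"
    using sum_edge_prob_squared_le[OF V] unfolding d_def by simp
  also have "n / (\<delta> * n) + (2 * n) / (\<delta> * n) = 3 / \<delta>"
    using n \<delta> by (simp add: field_simps)
  finally show ?thesis using sum_excess_le unfolding n_def by simp
qed

end

section \<open>Recovering coefficients from values of the generating function\<close>

text \<open>The points are fixed before the sequence \<open>c\<close>, so they serve all graphs and
  trees at once. By induction on \<open>K\<close>: at a small \<open>x\<close>, the value, the
  earlier coefficients and the tail contribute at most one quarter, one quarter and one half of
  \<open>\<epsilon> * x ^ K\<close>; dividing by \<open>x ^ K\<close> bounds the next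
  coefficient.\<close>

lemma coefficients_small_if_values_small:
  fixes \<epsilon> :: real
  assumes "\<epsilon> > 0"
  obtains X \<eta> where "finite X" "X \<subseteq> {0<..<1::real}" "\<eta> > 0"
    "\<And>c j. \<lbrakk>\<And>i::nat. \<bar>c i\<bar> \<le> 1; \<And>x. x \<in> X \<Longrightarrow> \<bar>\<Sum>i. c i * x ^ i\<bar> \<le> \<eta>; j < K\<rbrakk> \<Longrightarrow> \<bar>c j\<bar> \<le> (\<epsilon>::real)"
proof -
  have "\<exists>X \<eta>. finite X \<and> X \<subseteq> {0<..<1::real} \<and> \<eta> > 0 \<and>
    (\<forall>c::nat \<Rightarrow> real. (\<forall>i. \<bar>c i\<bar> \<le> 1) \<longrightarrow> (\<forall>x\<in>X. \<bar>\<Sum>i. c i * x ^ i\<bar> \<le> \<eta>) \<longrightarrow> (\<forall>j<K. \<bar>c j\<bar> \<le> \<epsilon>))"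
    using assms
  proof (induction K arbitrary: \<epsilon>)
    case 0
    then show ?case by (intro exI[of _ "{}"] exI[of _ 1]) auto
  next
    case (Suc K)
    \<comment> \<open>The tail is at most \<open>x ^ Suc K / (1 - x)\<close>; the bound 1/2 takes
      care of the denominator and \<open>\<epsilon> / 4\<close> of the extra factor
      \<open>x\<close>.\<close>
    define x where "x = min (1 / 2) (\<epsilon> / 4)"
    have x: "0 < x" "x \<le> 1 / 2" "x \<le> \<epsilon> / 4" using Suc.prems unfolding x_def by auto
    \<comment> \<open>Accuracy demanded of the \<open>K\<close> earlier coefficients, so that
      together they cost at most \<open>\<epsilon> * x ^ K / 4\<close>.\<close>
    define e where "e = min \<epsilon> (\<epsilon> * x ^ K / (4 * (real K + 1)))"
    have e: "e > 0" "e \<le> \<epsilon>" "e \<le> \<epsilon> * x ^ K / (4 * (real K + 1))"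
      using Suc.prems x(1) unfolding e_def by auto
    obtain X \<eta> where X: "finite X" "X \<subseteq> {0<..<1::real}" "\<eta> > 0"
      and IH: "\<forall>c::nat \<Rightarrow> real. (\<forall>i. \<bar>c i\<bar> \<le> 1) \<longrightarrow> (\<forall>x\<in>X. \<bar>\<Sum>i. c i * x ^ i\<bar> \<le> \<eta>) \<longrightarrow> (\<forall>j<K. \<bar>c j\<bar> \<le> e)"
      using Suc.IH[OF e(1)] by blast
    define \<eta>' where "\<eta>' = min \<eta> (\<epsilon> * x ^ K / 4)"
    have \<eta>': "\<eta>' > 0" "\<eta>' \<le> \<eta>" "\<eta>' \<le> \<epsilon> * x ^ K / 4"
      using X(3) Suc.prems x(1) unfolding \<eta>'_def by auto
    have "\<bar>c j\<bar> \<le> \<epsilon>" if c: "\<forall>i. \<bar>c i\<bar> \<le> 1" and small: "\<forall>y\<in>insert x X. \<bar>\<Sum>i. c i * y ^ i\<bar> \<le> \<eta>'" and j: "j < Suc K"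
      for c :: "nat \<Rightarrow> real" and j
    proof -
      have low: "\<bar>c i\<bar> \<le> e" if "i < K" for i
        using IH c small \<eta>'(2) that by force
      have x1: "\<bar>x\<bar> < 1" using x by simp
      have geo: "summable (\<lambda>i. x ^ (i + Suc K))"
        using x1 by (intro summable_ignore_initial_segment summable_geometric) simp
      have bound: "norm (c i * x ^ i) \<le> x ^ i" for i
        using c x(1) by (simp add: abs_mult mult_left_le_one_le)
      have summ: "summable (\<lambda>i. c i * x ^ i)"
        using x1 bound by (intro summable_comparison_test'[OF summable_geometric, of x 0]) simp_all
      define t where "t = (\<Sum>i. c (i + Suc K) * x ^ (i + Suc K))"
      define h where "h = (\<Sum>i<K. c i * x ^ i)"
      have dec: "(\<Sum>i. c i * x ^ i) = t + (h + c K * x ^ K)"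
        using suminf_split_initial_segment[OF summ, of "Suc K"] unfolding t_def h_def by simp
      have "\<bar>t\<bar> \<le> (\<Sum>i. x ^ (i + Suc K))"
        unfolding t_def real_norm_def[symmetric]
        by (intro norm_suminf_le bound geo)
      also have "\<dots> = x ^ Suc K / (1 - x)"
        using sums_mult[OF geometric_sums[of x], of "x ^ Suc K"] x1
        by (intro sums_unique[symmetric]) (simp add: power_add mult_ac)
      also have "\<dots> \<le> x ^ Suc K * 2"
        using x by (simp add: field_simps)
      also have "\<dots> \<le> \<epsilon> * x ^ K / 2"
        using x mult_right_mono[OF x(3), of "x ^ K"] by simp
      finally have t: "\<bar>t\<bar> \<le> \<epsilon> * x ^ K / 2" .
      have "\<bar>h\<bar> \<le> (\<Sum>i<K. \<bar>c i * x ^ i\<bar>)" unfolding h_def by (rule sum_abs)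
      also have "\<dots> \<le> (\<Sum>i<K. e)"
      proof (rule sum_mono)
        fix i assume "i \<in> {..<K}"
        then have "\<bar>c i\<bar> * x ^ i \<le> e * 1"
          using low x e(1) by (intro mult_mono power_le_one) auto
        then show "\<bar>c i * x ^ i\<bar> \<le> e" using x(1) by (simp add: abs_mult)
      qed
      also have "\<dots> \<le> (real K + 1) * e" using e(1) by simp
      also have "\<dots> \<le> \<epsilon> * x ^ K / 4"
        using e(3) by (simp add: field_simps)
      finally have h: "\<bar>h\<bar> \<le> \<epsilon> * x ^ K / 4" .
      have "\<bar>(\<Sum>i. c i * x ^ i)\<bar> \<le> \<epsilon> * x ^ K / 4" using small \<eta>'(3) by force
      then have "\<bar>c K * x ^ K\<bar> \<le> \<epsilon> * x ^ K"
        using t h unfolding dec by linarith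
      then have "\<bar>c K\<bar> * x ^ K \<le> \<epsilon> * x ^ K"
        using x(1) by (simp add: abs_mult)
      then have "\<bar>c K\<bar> \<le> \<epsilon>" using x(1) by simp
      then show ?thesis
        using low[of j] e(2) j by (cases "j = K") auto
    qed
    then show ?case
      using X x \<eta>'(1) by (intro exI[of _ "insert x X"] exI[of _ \<eta>']) auto
  qed
  then obtain X \<eta> where X: "finite X" "X \<subseteq> {0<..<1::real}" "\<eta> > 0"
    and coeff: "\<forall>c::nat \<Rightarrow> real. (\<forall>i. \<bar>c i\<bar> \<le> 1) \<longrightarrow> (\<forall>x\<in>X. \<bar>\<Sum>i. c i * x ^ i\<bar> \<le> \<eta>) \<longrightarrow> (\<forall>j<K. \<bar>c j\<bar> \<le> \<epsilon>)"
    by blast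
  show ?thesis
  proof (rule that[OF X])
    fix c :: "nat \<Rightarrow> real" and j
    assume "\<And>i. \<bar>c i\<bar> \<le> 1" "\<And>x. x \<in> X \<Longrightarrow> \<bar>\<Sum>i. c i * x ^ i\<bar> \<le> \<eta>" "j < K"
    with coeff[rule_format, of c] show "\<bar>c j\<bar> \<le> \<epsilon>" by simp
  qed
qed

section \<open>Poisson weights\<close>

text \<open>Law of 1 plus a Poisson variable of mean \<open>m\<close>. The case \<open>j = 0\<close>
  is separate because \<open>j - 1\<close> truncates to 0.\<close>

definition shifted_poisson :: "real \<Rightarrow> nat \<Rightarrow> real" where
  "shifted_poisson m j = (if j = 0 then 0 else exp (- m) * m ^ (j - 1) / fact (j - 1))"

lemma shifted_poisson_bounds:
  assumes "0 \<le> m"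
  shows "0 \<le> shifted_poisson m j" "shifted_poisson m j \<le> 1"
proof -
  have "m ^ k / fact k \<le> exp m" for k
  proof -
    have "m ^ k /\<^sub>R fact k \<le> (\<Sum>n. m ^ n /\<^sub>R fact n)"
      using assms sum_le_suminf[OF summable_exp_generic[of m], of "{k}"] by simp
    then show ?thesis unfolding exp_def by (simp add: divide_inverse mult.commute)
  qed
  from this[of "j - 1"] have "exp (- m) * (m ^ (j - 1) / fact (j - 1)) \<le> exp (- m) * exp m"
    by (intro mult_left_mono) auto
  then show "shifted_poisson m j \<le> 1"
    unfolding shifted_poisson_def by (simp add: exp_minus)
  show "0 \<le> shifted_poisson m j"
    using assms unfolding shifted_poisson_def by simp
qed

lemma shifted_poisson_sums: "(\<lambda>j. shifted_poisson m j * x ^ j) sums (x * exp (- (1 - x) * m))"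
proof (rule sums_Suc_imp)
  have "(\<lambda>n. (exp (- m) * x) * ((m * x) ^ n /\<^sub>R fact n)) sums (exp (- m) * x * exp (m * x))"
    by (intro sums_mult exp_converges)
  moreover have "exp (- m) * x * exp (m * x) = x * exp (- (1 - x) * m)"
    by (simp add: exp_add[symmetric] algebra_simps)
  moreover have "(exp (- m) * x) * ((m * x) ^ n /\<^sub>R fact n) = shifted_poisson m (Suc n) * x ^ Suc n" for n
    unfolding shifted_poisson_def by (simp add: power_mult_distrib divide_inverse mult_ac)
  ultimately show "(\<lambda>n. shifted_poisson m (Suc n) * x ^ Suc n) sums (x * exp (- (1 - x) * m))"
    by (simp only:)
qed (simp add: shifted_poisson_def)

text \<open>Tangent of \<open>exp (- m)\<close> at \<open>m = 1\<close>. Being linear in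
  \<open>m\<close>, it can be summed over vertices knowing only the mean of
  \<open>m\<close>.\<close>

lemma shifted_poisson_1_ge: "exp (- 1) * (2 - m) \<le> shifted_poisson m 1"
proof -
  have "exp (- 1) * (2 - m) \<le> exp (- 1) * exp (1 - m)"
    using exp_ge_add_one_self[of "1 - m"] by (intro mult_left_mono) auto
  then show ?thesis
    unfolding shifted_poisson_def by (simp add: exp_add[symmetric])
qed

lemma shifted_poisson_2_le: "shifted_poisson m 2 \<le> exp (- 1)"
proof -
  have "exp (- m) * m \<le> exp (- m) * exp (m - 1)"
    using exp_ge_add_one_self[of "m - 1"] by (intro mult_left_mono) auto
  then show ?thesis
    unfolding shifted_poisson_def by (simp add: exp_add[symmetric])
qed

text \<open>One factor \<open>m\<close> is kept aside and the remaining
  \<open>m ^ (k - 2) * exp (- m)\<close> is bounded by its maximum, at \<open>m = k - 2\<close>; the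
  result is linear in \<open>m\<close> and can be summed over vertices.\<close>

lemma shifted_poisson_le:
  assumes "0 \<le> m" "3 \<le> k"
  shows "shifted_poisson m k \<le> m * (1 / fact (k - 1) * (real (k - 2) ^ (k - 2) / exp 1 ^ (k - 2)))"
proof -
  define j where "j = k - 2"
  have j: "j > 0" "k - 1 = Suc j" using assms(2) unfolding j_def by auto
  have "m / real j \<le> exp (m / real j - 1)"
    using exp_ge_add_one_self[of "m / real j - 1"] by simp
  then have "(m / real j) ^ j \<le> exp (m / real j - 1) ^ j"
    using assms(1) by (intro power_mono) auto
  also have "\<dots> = exp (m - real j)"
    using j(1) by (simp add: exp_of_nat_mult[symmetric] algebra_simps)
  finally have "m ^ j \<le> real j ^ j * exp (m - real j)"
    using j(1) by (simp add: power_divide field_simps)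
  then have "exp (- m) * m ^ j \<le> exp (- m) * (real j ^ j * exp (m - real j))"
    by (intro mult_left_mono) auto
  also have "\<dots> = real j ^ j / exp 1 ^ j"
    by (simp add: exp_diff exp_minus exp_of_nat_mult[symmetric])
  finally have "m * (exp (- m) * m ^ j) / fact (Suc j) \<le> m * (real j ^ j / exp 1 ^ j) / fact (Suc j)"
    using assms(1) by (intro divide_right_mono mult_left_mono) auto
  then show ?thesis
    using assms(2) unfolding shifted_poisson_def j(2) j_def[symmetric] by (simp add: mult_ac)
qed

section \<open>The degree distribution\<close>

context connected_simple_graph
begin

text \<open>A count, not divided by \<open>card V\<close>: the expected number of vertices of degree
  \<open>k\<close> under the Poisson approximation.\<close>

definition poisson_avg :: "nat \<Rightarrow> real" where
  "poisson_avg k = (\<Sum>v\<in>V. shifted_poisson (mean_degree v - 1) k)"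

text \<open>Presents the deviation of the generating function as a power series in the deviations of
  the counts, the form to which \<open>coefficients_small_if_values_small\<close> applies.\<close>

lemma degree_deviation_sums:
  "(\<lambda>j. (real (num_degree V j T) - poisson_avg j) * x ^ j) sums
    ((\<Sum>v\<in>V. x ^ vertex_degree T v) - (\<Sum>v\<in>V. pgf_limit x v))"
proof -
  have "(\<lambda>j. (if j = vertex_degree T v then x ^ j else 0)) sums (x ^ vertex_degree T v)" for v
    using sums_single[of "vertex_degree T v" "\<lambda>j. x ^ j"] by simp
  then have "(\<lambda>j. (\<Sum>v\<in>V. (if j = vertex_degree T v then x ^ j else 0)) - (\<Sum>v\<in>V. shifted_poisson (mean_degree v - 1) j * x ^ j)) sums
      ((\<Sum>v\<in>V. x ^ vertex_degree T v) - (\<Sum>v\<in>V. pgf_limit x v))"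
    unfolding pgf_limit_def by (intro sums_diff sums_sum shifted_poisson_sums)
  moreover have "(\<Sum>v\<in>V. (if j = vertex_degree T v then x ^ j else 0)) = real (num_degree V j T) * x ^ j" for j
  proof -
    have "(\<Sum>v\<in>V. (if j = vertex_degree T v then x ^ j else 0)) = (\<Sum>v\<in>{v \<in> V. j = vertex_degree T v}. x ^ j)"
      by (rule sum.inter_filter[OF finite_V, symmetric])
    then show ?thesis
      unfolding num_degree_def by (simp add: eq_commute[of j])
  qed
  ultimately show ?thesis
    unfolding poisson_avg_def by (simp add: left_diff_distrib sum_distrib_right)
qed

lemma degree_deviation_bounded:
  assumes "2 \<le> card V"
  shows "\<bar>(real (num_degree V j T) - poisson_avg j) / real (card V)\<bar> \<le> 1"
proof -
  have "num_degree V j T \<le> card V"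
    unfolding num_degree_def using finite_V by (intro card_mono) auto
  moreover have "0 \<le> poisson_avg j" "poisson_avg j \<le> real (card V)"
    unfolding poisson_avg_def using shifted_poisson_bounds mean_degree_ge_1[OF _ assms]
    by (auto intro!: sum_nonneg sum_bounded_above[where K = 1, simplified])
  ultimately have "\<bar>real (num_degree V j T) - poisson_avg j\<bar> \<le> real (card V)"
    by linarith
  then show ?thesis
    using assms by (simp add: abs_divide divide_le_eq_1)
qed

text \<open>The pointwise bounds are constant or linear in \<open>mean_degree v - 1\<close>, and
  these numbers sum to \<open>card V - 2\<close>.\<close>

lemma poisson_avg_bounds:
  assumes "2 \<le> card V"
  shows "exp (- 1) * real (card V) \<le> poisson_avg 1"
    and "poisson_avg 2 \<le> exp (- 1) * real (card V)"
    and "3 \<le> k \<Longrightarrow> poisson_avg k \<le> (1 / fact (k - 1) * (real (k - 2) ^ (k - 2) / exp 1 ^ (k - 2))) * real (card V)"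
proof -
  have m: "(\<Sum>v\<in>V. mean_degree v - 1) \<le> real (card V)"
    by (simp add: sum_subtractf sum_mean_degree)
  have "real (card V) \<le> (\<Sum>v\<in>V. 2 - (mean_degree v - 1))"
    using m by (simp only: sum_subtractf) simp
  then have "exp (- 1) * real (card V) \<le> exp (- 1) * (\<Sum>v\<in>V. 2 - (mean_degree v - 1))"
    by (intro mult_left_mono) auto
  also have "\<dots> \<le> poisson_avg 1"
    unfolding poisson_avg_def sum_distrib_left by (intro sum_mono shifted_poisson_1_ge)
  finally show "exp (- 1) * real (card V) \<le> poisson_avg 1" .
  have "poisson_avg 2 \<le> (\<Sum>v\<in>V. exp (- 1))"
    unfolding poisson_avg_def by (intro sum_mono shifted_poisson_2_le)
  then show "poisson_avg 2 \<le> exp (- 1) * real (card V)" by (simp add: mult.commute)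
  assume k: "3 \<le> k"
  define C where "C = 1 / fact (k - 1) * (real (k - 2) ^ (k - 2) / exp 1 ^ (k - 2))"
  have "poisson_avg k \<le> (\<Sum>v\<in>V. (mean_degree v - 1) * C)"
    unfolding poisson_avg_def C_def using mean_degree_ge_1[OF _ assms] k
    by (intro sum_mono shifted_poisson_le) auto
  also have "\<dots> = C * (\<Sum>v\<in>V. mean_degree v - 1)"
    by (simp add: sum_distrib_left mult.commute)
  also have "\<dots> \<le> C * real (card V)"
    using m unfolding C_def by (intro mult_left_mono) auto
  finally show "poisson_avg k \<le> C * real (card V)" .
qed

text \<open>Chebyshev's inequality at each point of \<open>X\<close> and a union bound.\<close>

lemma prob_le_of_pgf_deviation:
  assumes V: "3 \<le> card V" and X: "finite X" "X \<subseteq> {0..1}" and \<eta>: "\<eta> > 0"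
    and B: "\<And>T. T \<in> trees \<Longrightarrow> T \<in> B \<Longrightarrow>
      \<exists>x\<in>X. \<eta> * real (card V) < \<bar>(\<Sum>v\<in>V. x ^ vertex_degree T v) - (\<Sum>v\<in>V. pgf_limit x v)\<bar>"
  shows "measure_pmf.prob (uniform_spanning_tree V E) B
    \<le> real (card X) * (5 + (\<Sum>v\<in>V. excess v)) / (\<eta>\<^sup>2 * real (card V))"
proof -
  define n where "n = real (card V)"
  define Y where "Y x T = (\<Sum>v\<in>V. x ^ vertex_degree T v) - (\<Sum>v\<in>V. pgf_limit x v)" for x T
  have n: "n > 0" using V unfolding n_def by simp
  have "measure_pmf.prob (uniform_spanning_tree V E) B = avg trees (\<lambda>T. of_bool (T \<in> B))"
    unfolding uniform_spanning_tree_def avg_def measure_pmf_of_set[OF trees_nonempty finite_trees]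
    using finite_trees by (simp add: of_bool_def sum.If_cases)
  also have "\<dots> \<le> avg trees (\<lambda>T. \<Sum>x\<in>X. 1 / (\<eta> * n)\<^sup>2 * (Y x T)\<^sup>2)"
  proof (rule avg_mono)
    fix T assume T: "T \<in> trees"
    show "of_bool (T \<in> B) \<le> (\<Sum>x\<in>X. 1 / (\<eta> * n)\<^sup>2 * (Y x T)\<^sup>2)"
    proof (cases "T \<in> B")
      case True
      obtain x where x: "x \<in> X" "\<eta> * n < \<bar>Y x T\<bar>"
        using B[OF T True] unfolding Y_def n_def by blast
      have "(\<eta> * n)\<^sup>2 \<le> (Y x T)\<^sup>2"
        using x(2) \<eta> n by (simp add: abs_le_square_iff[symmetric])
      then have "1 \<le> 1 / (\<eta> * n)\<^sup>2 * (Y x T)\<^sup>2"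
        using \<eta> n by simp
      also have "\<dots> \<le> (\<Sum>x\<in>X. 1 / (\<eta> * n)\<^sup>2 * (Y x T)\<^sup>2)"
        using x(1) X(1) by (intro member_le_sum) auto
      finally show ?thesis using True by simp
    qed (auto intro!: sum_nonneg)
  qed
  also have "\<dots> = (\<Sum>x\<in>X. 1 / (\<eta> * n)\<^sup>2 * avg trees (\<lambda>T. (Y x T)\<^sup>2))"
    unfolding avg_sum avg_cmult ..
  also have "\<dots> \<le> (\<Sum>x\<in>X. 1 / (\<eta> * n)\<^sup>2 * (n * (5 + (\<Sum>v\<in>V. excess v))))"
    using pgf_second_moment[OF V] X(2) unfolding Y_def n_def by (intro sum_mono mult_left_mono) auto
  also have "\<dots> = real (card X) * (5 + (\<Sum>v\<in>V. excess v)) / (\<eta>\<^sup>2 * n)"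
    using n by (simp add: power2_eq_square)
  finally show ?thesis unfolding n_def .
qed

text \<open>Vertices of degree \<open>k\<close> use up \<open>k\<close> each of the total degree;
  this settles all large \<open>k\<close> without concentration.\<close>

lemma num_degree_times_le:
  assumes "T \<in> trees"
  shows "real k * real (num_degree V k T) \<le> 2 * (real (card V) - 1)"
proof -
  have "k * num_degree V k T = (\<Sum>v\<in>{v \<in> V. vertex_degree T v = k}. vertex_degree T v)"
    unfolding num_degree_def by simp
  also have "\<dots> \<le> (\<Sum>v\<in>V. vertex_degree T v)"
    using finite_V by (intro sum_mono2) auto
  finally have "k * num_degree V k T \<le> 2 * (card V - 1)"
    unfolding sum_vertex_degree_tree[OF assms] .
  then have "real (k * num_degree V k T) \<le> real (2 * (card V - 1))"
    by (rule of_nat_mono)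
  moreover have "1 \<le> card V"
    using finite_V V_nonempty by (simp add: Suc_le_eq card_gt_0_iff)
  ultimately show ?thesis by (simp add: of_nat_diff)
qed

end

theorem theorem1p5:
  fixes \<epsilon> \<delta> :: real
  assumes "\<epsilon> > 0" and "\<delta> > 0"
  shows "\<exists>(n\<^sub>0::nat) (\<gamma>::real). \<gamma> > 0 \<and>
    (\<forall>(V::'a set) (E::'a set set) (n::nat).
       finite_simple_graph V E \<and> connected_graph V E \<and> card V = n \<and> n \<ge> n\<^sub>0 \<and>
       real (card {v \<in> V. real (vertex_degree E v) \<ge> \<delta> * real n}) \<ge> (1 - \<gamma>) * real n
       \<longrightarrow>
       measure_pmf.prob (uniform_spanning_tree V E)
         {T. real (num_degree V 1 T) \<le> (exp (- 1) - \<epsilon>) * real n} \<le> \<epsilon> \<and>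
       measure_pmf.prob (uniform_spanning_tree V E)
         {T. real (num_degree V 2 T) \<ge> (exp (- 1) + \<epsilon>) * real n} \<le> \<epsilon> \<and>
       (\<forall>k::nat. k \<ge> 3 \<longrightarrow>
          measure_pmf.prob (uniform_spanning_tree V E)
            {T. real (num_degree V k T) \<ge>
                  (1 / fact (k - 1) * (real (k - 2) ^ (k - 2) / exp 1 ^ (k - 2)) + \<epsilon>) * real n}
          \<le> \<epsilon>))"
proof -
  \<comment> \<open>For \<open>k \<ge> K\<close> the degree sum already forces fewer than
    \<open>\<epsilon> * n\<close> vertices of degree \<open>k\<close>; adding 3 puts 1 and 2 below
    \<open>K\<close>.\<close>
  define K where "K = nat \<lceil>2 / \<epsilon>\<rceil> + 3"
  have K: "2 / \<epsilon> \<le> real k" if "K \<le> k" for k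
    using that real_nat_ceiling_ge[of "2 / \<epsilon>"] unfolding K_def by linarith
  \<comment> \<open>Half of \<open>\<epsilon>\<close> leaves a strict gap to the events, which are
    given by non-strict inequalities.\<close>
  have "\<epsilon> / 2 > 0" using assms(1) by simp
  then obtain X \<eta> where X: "finite X" "X \<subseteq> {0<..<1::real}" and \<eta>: "\<eta> > 0"
    and coeff: "\<And>c j. \<lbrakk>\<And>i::nat. \<bar>c i\<bar> \<le> 1; \<And>x. x \<in> X \<Longrightarrow> \<bar>\<Sum>i. c i * x ^ i\<bar> \<le> \<eta>; j < K\<rbrakk> \<Longrightarrow> \<bar>c j\<bar> \<le> \<epsilon> / 2"
    using coefficients_small_if_values_small[of "\<epsilon> / 2" K] by blast
  \<comment> \<open>Adding 1 keeps \<open>M\<close> positive if \<open>X\<close> is empty. In the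
    Chebyshev bound, \<open>\<gamma>\<close> makes the term from low-degree vertices at most
    \<open>\<epsilon> / 2\<close>, and \<open>n \<ge> R\<close> does the same for the remaining
    terms.\<close>
  define M where "M = real (card X) + 1"
  define \<gamma> where "\<gamma> = \<epsilon> * \<eta>\<^sup>2 / (4 * M)"
  define R where "R = 2 * M * (5 + 3 / \<delta>) / (\<eta>\<^sup>2 * \<epsilon>)"
  define n\<^sub>0 where "n\<^sub>0 = nat \<lceil>R\<rceil> + 3"
  have M: "M > 0" "real (card X) \<le> M" unfolding M_def by auto
  have \<gamma>: "\<gamma> > 0" unfolding \<gamma>_def using assms(1) \<eta> M by simp
  have main: "measure_pmf.prob (uniform_spanning_tree V E)
         {T. real (num_degree V 1 T) \<le> (exp (- 1) - \<epsilon>) * real (card V)} \<le> \<epsilon> \<and>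
       measure_pmf.prob (uniform_spanning_tree V E)
         {T. real (num_degree V 2 T) \<ge> (exp (- 1) + \<epsilon>) * real (card V)} \<le> \<epsilon> \<and>
       (\<forall>k::nat. k \<ge> 3 \<longrightarrow>
          measure_pmf.prob (uniform_spanning_tree V E)
            {T. real (num_degree V k T) \<ge>
                  (1 / fact (k - 1) * (real (k - 2) ^ (k - 2) / exp 1 ^ (k - 2)) + \<epsilon>) * real (card V)}
          \<le> \<epsilon>)"
    if simple: "finite_simple_graph V E" and conn: "connected_graph V E" and n0: "card V \<ge> n\<^sub>0"
      and good: "real (card {v \<in> V. real (vertex_degree E v) \<ge> \<delta> * real (card V)}) \<ge> (1 - \<gamma>) * real (card V)"
    for V :: "'a set" and E
  proof -
    interpret connected_simple_graph V E
      using simple conn by unfold_locales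
    define n where "n = real (card V)"
    have V3: "3 \<le> card V" and V2: "2 \<le> card V" using n0 unfolding n\<^sub>0_def by auto
    have n: "n > 0" "R \<le> n"
      using V3 n0 real_nat_ceiling_ge[of R] unfolding n_def n\<^sub>0_def by linarith+
    have "(\<Sum>v\<in>V. excess v) \<le> 3 / \<delta> + 2 * \<gamma> * n"
      using sum_excess_le_of_degrees[OF V2 assms(2) good] unfolding n_def .
    moreover have "0 \<le> (\<Sum>v\<in>V. excess v)"
      using pgf_degree_lower(2)[OF _ V2, of _ 0] by (intro sum_nonneg) auto
    ultimately have "real (card X) * (5 + (\<Sum>v\<in>V. excess v)) \<le> M * (5 + 3 / \<delta> + 2 * \<gamma> * n)"
      using M by (intro mult_mono) auto
    also have "\<dots> = \<eta>\<^sup>2 * \<epsilon> / 2 * (R + n)"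
      unfolding R_def \<gamma>_def using M(1) \<eta> assms by (simp add: field_simps)
    also have "\<dots> \<le> \<eta>\<^sup>2 * \<epsilon> / 2 * (n + n)"
      using n(2) assms(1) by (intro mult_left_mono) auto
    finally have small: "real (card X) * (5 + (\<Sum>v\<in>V. excess v)) / (\<eta>\<^sup>2 * n) \<le> \<epsilon>"
      using \<eta> n(1) by (simp add: divide_le_eq mult_ac)
    \<comment> \<open>If the generating function were close at every point of \<open>X\<close>, all
      counts with index below \<open>K\<close> would be close to their Poisson values; so a
      deviation in one count shows at some point of \<open>X\<close>.\<close>
    have event: "measure_pmf.prob (uniform_spanning_tree V E) B \<le> \<epsilon>"
      if k: "k < K" and B: "\<And>T. T \<in> B \<Longrightarrow> \<epsilon> * n \<le> \<bar>real (num_degree V k T) - poisson_avg k\<bar>" for B k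
    proof -
      have "\<exists>x\<in>X. \<eta> * n < \<bar>(\<Sum>v\<in>V. x ^ vertex_degree T v) - (\<Sum>v\<in>V. pgf_limit x v)\<bar>"
        if "T \<in> B" for T
      proof (rule ccontr)
        assume neg: "\<not> ?thesis"
        define c where "c j = (real (num_degree V j T) - poisson_avg j) / n" for j
        have "\<bar>c k\<bar> \<le> \<epsilon> / 2"
        proof (rule coeff[OF _ _ k])
          show "\<bar>c i\<bar> \<le> 1" for i
            unfolding c_def n_def by (rule degree_deviation_bounded[OF V2])
          fix x assume x: "x \<in> X"
          have "(\<Sum>i. c i * x ^ i) = ((\<Sum>v\<in>V. x ^ vertex_degree T v) - (\<Sum>v\<in>V. pgf_limit x v)) / n"
            using sums_divide[OF degree_deviation_sums[of T x], of n] unfolding c_def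
            by (intro sums_unique[symmetric]) simp
          then show "\<bar>\<Sum>i. c i * x ^ i\<bar> \<le> \<eta>"
            using neg x n(1) by (auto simp: not_less divide_le_eq)
        qed
        then have "\<bar>real (num_degree V k T) - poisson_avg k\<bar> \<le> \<epsilon> / 2 * n"
          using n(1) unfolding c_def by (simp add: divide_le_eq)
        moreover have "\<epsilon> / 2 * n < \<epsilon> * n" using n(1) assms(1) by simp
        ultimately show False using B[OF that] by linarith
      qed
      then have "measure_pmf.prob (uniform_spanning_tree V E) B
          \<le> real (card X) * (5 + (\<Sum>v\<in>V. excess v)) / (\<eta>\<^sup>2 * n)"
        using X unfolding n_def by (intro prob_le_of_pgf_deviation[OF V3 _ _ \<eta>]) auto
      then show ?thesis using small by linarith
    qed
    note p = poisson_avg_bounds[OF V2, folded n_def]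
    have "measure_pmf.prob (uniform_spanning_tree V E)
         {T. real (num_degree V 1 T) \<le> (exp (- 1) - \<epsilon>) * n} \<le> \<epsilon>"
    proof (rule event[of 1])
      fix T assume "T \<in> {T. real (num_degree V 1 T) \<le> (exp (- 1) - \<epsilon>) * n}"
      then have "real (num_degree V 1 T) \<le> exp (- 1) * n - \<epsilon> * n"
        by (simp add: left_diff_distrib)
      then show "\<epsilon> * n \<le> \<bar>real (num_degree V 1 T) - poisson_avg 1\<bar>"
        using p(1) by linarith
    qed (simp add: K_def)
    moreover have "measure_pmf.prob (uniform_spanning_tree V E)
         {T. real (num_degree V 2 T) \<ge> (exp (- 1) + \<epsilon>) * n} \<le> \<epsilon>"
    proof (rule event[of 2])
      fix T assume "T \<in> {T. real (num_degree V 2 T) \<ge> (exp (- 1) + \<epsilon>) * n}"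
      then have "exp (- 1) * n + \<epsilon> * n \<le> real (num_degree V 2 T)"
        by (simp add: distrib_right)
      then show "\<epsilon> * n \<le> \<bar>real (num_degree V 2 T) - poisson_avg 2\<bar>"
        using p(2) by linarith
    qed (simp add: K_def)
    moreover have "measure_pmf.prob (uniform_spanning_tree V E)
        {T. real (num_degree V k T) \<ge>
          (1 / fact (k - 1) * (real (k - 2) ^ (k - 2) / exp 1 ^ (k - 2)) + \<epsilon>) * n} \<le> \<epsilon>"
      if k: "3 \<le> k" for k
    proof -
      define C :: real where "C = 1 / fact (k - 1) * (real (k - 2) ^ (k - 2) / exp 1 ^ (k - 2))"
      have C: "0 \<le> C" unfolding C_def by simp
      have "measure_pmf.prob (uniform_spanning_tree V E) {T. real (num_degree V k T) \<ge> (C + \<epsilon>) * n} \<le> \<epsilon>"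
      proof (cases "k < K")
        case True
        show ?thesis
        proof (rule event[OF True])
          fix T assume "T \<in> {T. real (num_degree V k T) \<ge> (C + \<epsilon>) * n}"
          then have "C * n + \<epsilon> * n \<le> real (num_degree V k T)"
            by (simp add: distrib_right)
          then show "\<epsilon> * n \<le> \<bar>real (num_degree V k T) - poisson_avg k\<bar>"
            using p(3)[OF k, folded C_def] by linarith
        qed
      next
        \<comment> \<open>The event then contains no spanning tree at all.\<close>
        case False
        then have "2 \<le> \<epsilon> * real k"
          using K[of k] assms(1) by (simp add: field_simps)
        then have 2: "2 * n \<le> \<epsilon> * real k * n"
          using n(1) by (intro mult_right_mono) auto
        have "\<not> (C + \<epsilon>) * n \<le> real (num_degree V k T)" if T: "T \<in> trees" for T
        proof
          assume "(C + \<epsilon>) * n \<le> real (num_degree V k T)"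
          moreover have "\<epsilon> * n \<le> (C + \<epsilon>) * n" using C n(1) by (intro mult_right_mono) auto
          ultimately have "real k * (\<epsilon> * n) \<le> real k * real (num_degree V k T)"
            by (intro mult_left_mono) auto
          then show False
            using num_degree_times_le[OF T, of k] 2 unfolding n_def by (simp add: mult_ac)
        qed
        then have "trees \<inter> {T. real (num_degree V k T) \<ge> (C + \<epsilon>) * n} = {}" by blast
        then show ?thesis
          unfolding uniform_spanning_tree_def measure_pmf_of_set[OF trees_nonempty finite_trees]
          using assms(1) by simp
      qed
      then show ?thesis unfolding C_def .
    qed
    ultimately show ?thesis unfolding n_def by blast
  qed
  show ?thesis
    by (intro exI[of _ n\<^sub>0] exI[of _ \<gamma>] conjI[OF \<gamma>] allI impI) (use main in blast)
qed

end
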